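(* Let $d\ge 1$ be a fixed integer. There is a RAM with addition (i.e. a RAM whose only primitive arithmetic operation is addition) such that, for any input integer $N>0$: (1) (pre-computation) the RAM computes some tables in time $O(N)$; (2) (division) using these pre-computed tables and reading any integers $a,b<N^d$ with $b>0$, the RAM computes in constant time $O(d^4)$ the quotient $\lfloor a/b\rfloor$ and the remainder $a \bmod b$.
   Context: RAM model: a machine with registers holding natural numbers: an accumulator $A$, a buffer $B$, work registers $R[0],R[1],\dots$ (initially $0$), and an input size register $N$ (possibly with input registers $I[0],\dots,I[N-1]$ with contents at most $cN$ for a fixed $c$). Its program is a finite sequence of instructions: $\mathtt{CST}\ j$ ($A\gets j$ for a fixed constant $j$), $\mathtt{Buffer}$ ($B\gets A$), $\mathtt{Store}$ ($R[A]\gets B$), $\mathtt{Load}$ ($A\gets R[A]$), $\mathtt{Jzero}\ \ell_0\ \ell_1$ (jump to $\ell_0$ if $A=0$, else to $\ell_1$), $\mathtt{getN}$ ($A\gets N$), $\mathtt{Input}$ ($A\gets I[A]$), $\mathtt{Output}$, and $A\gets \mathtt{op}(A,B)$ for each allowed operation $\mathtt{op}$ (here only addition). Each instruction costs one time unit (unit cost criterion), and all register contents and addresses are $O(N)$. An integer less than $N^d$ (a "polynomial" integer) is handled as a constant number $O(d)$ of registers holding its digits in a base of order $N^{1/2}$ (conversion between such bases is immediate); the time bound in (2) is constant for fixed $d$. *)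

theory Defs
  imports Complex_Main
begin

datatype instr =
    Cst nat
  | Buffer
  | Store
  | Load
  | Jzero nat nat
  | GetN
  | Input
  | Output
  | Add

type_synonym program = "instr list"

record config =
  pc :: nat
  acc :: nat
  buf :: nat
  reg :: "nat \<Rightarrow> nat"
  out :: "nat list"

definition init :: config where
  "init = \<lparr>pc = 0, acc = 0, buf = 0, reg = (\<lambda>_. 0), out = []\<rparr>"

abbreviation goto :: "nat \<Rightarrow> config \<Rightarrow> config" where
  "goto l c \<equiv> c\<lparr>pc := l\<rparr>"

abbreviation advance :: "config \<Rightarrow> config" where
  "advance c \<equiv> goto (Suc (pc c)) c"

text \<open>
  \<open>N\<close> is the content of the size register and the list \<open>xs\<close> gives the contents of the input
  registers.  An \<open>Input\<close> whose address is not that of an input register blocks the machine: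
  such a run is not an execution in the sense of \<open>exec\<close> below.
\<close>

fun exec_instr :: "nat \<Rightarrow> nat list \<Rightarrow> instr \<Rightarrow> config \<Rightarrow> config option" where
  "exec_instr N xs (Cst j) c = Some (advance (c\<lparr>acc := j\<rparr>))"
| "exec_instr N xs Buffer c = Some (advance (c\<lparr>buf := acc c\<rparr>))"
| "exec_instr N xs Store c = Some (advance (c\<lparr>reg := (reg c)(acc c := buf c)\<rparr>))"
| "exec_instr N xs Load c = Some (advance (c\<lparr>acc := reg c (acc c)\<rparr>))"
| "exec_instr N xs (Jzero l0 l1) c = Some (goto (if acc c = 0 then l0 else l1) c)"
| "exec_instr N xs GetN c = Some (advance (c\<lparr>acc := N\<rparr>))"
| "exec_instr N xs Input c =
     (if acc c < length xs then Some (advance (c\<lparr>acc := xs ! acc c\<rparr>)) else None)"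
| "exec_instr N xs Output c = Some (advance (c\<lparr>out := out c @ [acc c]\<rparr>))"
| "exec_instr N xs Add c = Some (advance (c\<lparr>acc := acc c + buf c\<rparr>))"

definition step :: "program \<Rightarrow> nat \<Rightarrow> nat list \<Rightarrow> config \<Rightarrow> config option" where
  "step P N xs c = (if pc c < length P then exec_instr N xs (P ! pc c) c else None)"

text \<open>
  Every address used by an instruction is the content of the accumulator, so bounding the
  contents also bounds the addresses.
\<close>

definition bounded_by :: "nat \<Rightarrow> config \<Rightarrow> bool" where
  "bounded_by M c \<longleftrightarrow> acc c \<le> M \<and> buf c \<le> M \<and> (\<forall>i. reg c i \<le> M)"

text \<open>
  \<open>exec P N xs M c t c'\<close>: started in \<open>c\<close>, the program halts in \<open>c'\<close> after exactly \<open>t\<close>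
  instructions, and no register ever exceeds \<open>M\<close>.  The machine halts when the program
  counter leaves the program.
\<close>

inductive exec ::
  "program \<Rightarrow> nat \<Rightarrow> nat list \<Rightarrow> nat \<Rightarrow> config \<Rightarrow> nat \<Rightarrow> config \<Rightarrow> bool"
  for P :: program and N :: nat and xs :: "nat list" and M :: nat
where
  halt: "length P \<le> pc c \<Longrightarrow> bounded_by M c \<Longrightarrow> exec P N xs M c 0 c"
| more: "bounded_by M c \<Longrightarrow> step P N xs c = Some c' \<Longrightarrow> exec P N xs M c' t c'' \<Longrightarrow>
         exec P N xs M c (Suc t) c''"

definition base :: "nat \<Rightarrow> nat" where
  "base N = nat \<lceil>sqrt (real N)\<rceil>"

text \<open>Least significant digit first.\<close>

definition digits :: "nat \<Rightarrow> nat \<Rightarrow> nat \<Rightarrow> nat list" where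
  "digits \<beta> k x = map (\<lambda>i. x div \<beta> ^ i mod \<beta>) [0..<k]"

text \<open>
  An integer below \<open>N ^ d\<close> occupies \<open>2 * d\<close> registers; \<open>poly_digits_value\<close> shows that this is
  always enough.
\<close>

definition poly_digits :: "nat \<Rightarrow> nat \<Rightarrow> nat \<Rightarrow> nat list" where
  "poly_digits N d x = digits (base N) (2 * d) x"

lemma digits_value: "(\<Sum>i<k. (digits \<beta> k x ! i) * \<beta> ^ i) = x mod \<beta> ^ k"
proof -
  have "(\<Sum>i<k. (x div \<beta> ^ i mod \<beta>) * \<beta> ^ i) = x mod \<beta> ^ k"
  proof (induction k)
    case (Suc k)
    have "x mod (\<beta> ^ k * \<beta>) = \<beta> ^ k * (x div \<beta> ^ k mod \<beta>) + x mod \<beta> ^ k"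
      by (rule mod_mult2_eq)
    with Suc show ?case by (simp add: mult.commute)
  qed simp
  then show ?thesis by (simp add: digits_def)
qed

lemma le_base_sq: "N \<le> base N ^ 2"
proof -
  have "sqrt (real N) \<le> real (base N)"
    unfolding base_def by (rule real_nat_ceiling_ge)
  then have "(sqrt (real N))\<^sup>2 \<le> (real (base N))\<^sup>2"
    by (intro power_mono) auto
  then have "real N \<le> real (base N ^ 2)" by simp
  then show ?thesis by (simp only: of_nat_le_iff)
qed

lemma poly_digits_value:
  assumes "x < N ^ d"
  shows "(\<Sum>i<2 * d. (poly_digits N d x ! i) * base N ^ i) = x"
proof -
  have "N ^ d \<le> (base N ^ 2) ^ d" by (intro power_mono le_base_sq) simp
  then have "x < base N ^ (2 * d)" using assms by (simp add: power_mult)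
  then show ?thesis by (simp add: poly_digits_def digits_value)
qed

text \<open>
  The routine starting at label \<open>l\<close>, entered from the memory contents of \<open>c\<close> with \<open>a\<close> and \<open>b\<close>
  in the input registers, outputs \<open>a div b\<close> and \<open>a mod b\<close> in \<open>t\<close> steps and halts in \<open>c'\<close>.
\<close>

definition divides_in ::
  "program \<Rightarrow> nat \<Rightarrow> nat \<Rightarrow> nat \<Rightarrow> nat \<Rightarrow> config \<Rightarrow> nat \<Rightarrow> nat \<Rightarrow> nat \<Rightarrow> config \<Rightarrow> bool"
where
  "divides_in P l d N M c a b t c' \<longleftrightarrow>
     exec P N (poly_digits N d a @ poly_digits N d b) M (c\<lparr>pc := l, out := []\<rparr>) t c' \<and>
     out c' = poly_digits N d (a div b) @ poly_digits N d (a mod b)"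

end

theory Submission
  imports Defs
begin

text \<open>
  Let \<open>\<beta>\<close> be the base, about \<open>sqrt N\<close>.  Tables indexed by two digits have size \<open>\<beta>\<^sup>2 = O(N)\<close> and reduce
  digit multiplication, carries and complements to additions and look-ups.  Division is schoolbook
  long division.  To find a quotient digit in constant time, remainder and divisor are scaled by
  \<open>s = \<beta> div (b1 + 1)\<close>, where \<open>b1\<close> is the leading digit of the divisor.  The leading digit \<open>D\<close> of
  the scaled divisor is then at least \<open>\<beta> / 3\<close>, and if \<open>R\<close> is the leading digit of the scaled
  remainder, the tabulated number \<open>\<beta> * R div (D + 1)\<close> is at most the true quotient digit and at least
  that digit minus 7.  Seven conditional subtractions of the divisor correct it.
\<close>

section \<open>The machine language\<close>

text \<open>The obstacle is table size: \<open>O(N)\<close> entries can be indexed by two digits,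
  not by three. The usual trial digit, two leading digits of the remainder over one of the divisor,
  would need three. So one digit of each scaled number must suffice, and the price is a larger,
  still constant, error. Rounding the numerator down and the denominator up makes the estimate err
  in one direction only, so corrections are subtractions and nothing ever becomes negative. Scaled
  numbers serve the estimate alone; the remainder that is carried along is the true one and needs no
  unscaling. The program may depend on \<open>d\<close> but not on \<open>N\<close>. Division is
  therefore unrolled into loop-free code, whose running time can be read off the syntax. The
  precomputation does need loops whose length depends on \<open>N\<close>, on a machine that can
  only add and test for zero; hence predecessor and comparison are tabulated before anything else,
  and the other tables are filled by enumerating their indices rather than by computing quotients or
  products.\<close>

datatype col = TPred | TLess | THi | TLo | TMul | TRow | TQuo | Glob | Tmp | Norm
  | ColA | ColB | ColR | ColW | ColX | ColQ

primrec enc :: "col \<Rightarrow> nat" where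
  "enc TPred = 0" | "enc TLess = 1" | "enc THi = 2" | "enc TLo = 3"
| "enc TMul = 4" | "enc TRow = 5" | "enc TQuo = 6" | "enc Glob = 7"
| "enc Tmp = 8" | "enc Norm = 9" | "enc ColA = 10" | "enc ColB = 11"
| "enc ColR = 12" | "enc ColW = 13" | "enc ColX = 14" | "enc ColQ = 15"

type_synonym loc = "col \<times> nat"
type_synonym mem = "loc \<Rightarrow> nat"

text \<open>
  Columns are interleaved; register 0 belongs to no location and serves the compiler as scratch space.
\<close>

definition addr :: "loc \<Rightarrow> nat" where
  "addr x = Suc (16 * snd x + enc (fst x))"

lemma enc_less: "enc j < 16"
  by (cases j) auto

lemma inj_enc: "enc j = enc k \<longleftrightarrow> j = k"
  by (cases j; cases k) auto

lemma addr_eq_iff [simp]: "addr x = addr y \<longleftrightarrow> x = y"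
proof
  assume eq: "addr x = addr y"
  then have *: "16 * snd x + enc (fst x) = 16 * snd y + enc (fst y)"
    by (simp add: addr_def)
  then have "(16 * snd x + enc (fst x)) mod 16 = (16 * snd y + enc (fst y)) mod 16"
    by simp
  then have "enc (fst x) = enc (fst y)"
    using enc_less[of "fst x"] enc_less[of "fst y"] by simp
  with * show "x = y"
    by (simp add: inj_enc prod_eq_iff)
qed simp

lemma addr_neq_0 [simp]: "addr x \<noteq> 0" "0 \<noteq> addr x"
  by (simp_all add: addr_def)

section \<open>A small imperative language and its translation to RAM code\<close>

datatype com =
    Skip
  | Const loc nat
  | Size loc
  | Read loc nat
  | Move loc loc
  | Plus loc loc loc
  | Get loc col loc
  | Put col loc loc
  | Seq com com (infixr ";;" 60)
  | IfZero loc com com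
  | While loc com

definition fetch :: "loc \<Rightarrow> instr list" where
  "fetch x = [Cst (addr x), Load]"

definition deposit :: "loc \<Rightarrow> instr list" where
  "deposit x = [Buffer, Cst (addr x), Store]"

text \<open>The factor 16 is obtained by four doublings, addition being the only operation; this is
  why the number of columns is a power of two.\<close>

definition index :: "col \<Rightarrow> instr list" where
  "index j = [Buffer, Add, Buffer, Add, Buffer, Add, Buffer, Add, Buffer, Cst (Suc (enc j)), Add]"

primrec csize :: "com \<Rightarrow> nat" where
  "csize Skip = 0"
| "csize (Const x n) = 4"
| "csize (Size x) = 4"
| "csize (Read x n) = 5"
| "csize (Move x y) = 5"
| "csize (Plus x y z) = 9"
| "csize (Get x j y) = 17"
| "csize (Put j y z) = 22"
| "csize (c ;; d) = csize c + csize d"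
| "csize (IfZero x c d) = csize c + csize d + 4"
| "csize (While x c) = csize c + 4"

text \<open>A \<open>Jzero\<close> with equal targets is an unconditional jump. The final
  \<open>Store\<close> of \<open>Put\<close> occupies both accumulator and buffer, so the target
  address is parked in register 0 while the value is fetched.\<close>

primrec compile :: "nat \<Rightarrow> com \<Rightarrow> instr list" where
  "compile p Skip = []"
| "compile p (Const x n) = Cst n # deposit x"
| "compile p (Size x) = GetN # deposit x"
| "compile p (Read x n) = Cst n # Input # deposit x"
| "compile p (Move x y) = fetch y @ deposit x"
| "compile p (Plus x y z) = fetch y @ Buffer # fetch z @ Add # deposit x"
| "compile p (Get x j y) = fetch y @ index j @ Load # deposit x"
| "compile p (Put j y z) =
     fetch y @ index j @ [Buffer, Cst 0, Store] @ fetch z @ [Buffer, Cst 0, Load, Store]"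
| "compile p (c ;; d) = compile p c @ compile (p + csize c) d"
| "compile p (IfZero x c d) =
     fetch x @ Jzero (p + 3) (p + csize c + 4) # compile (p + 3) c @
     Jzero (p + csize c + csize d + 4) (p + csize c + csize d + 4) # compile (p + csize c + 4) d"
| "compile p (While x c) =
     fetch x @ Jzero (p + csize c + 4) (p + 3) # compile (p + 3) c @ [Jzero p p]"

lemma length_compile [simp]: "length (compile p c) = csize c"
  by (induction c arbitrary: p) (auto simp: fetch_def deposit_def index_def)

text \<open>
  \<open>L\<close> bounds all stored values; \<open>Q\<close> sees an upper bound on the time elapsed since the start.
\<close>

primrec wp ::
  "nat \<Rightarrow> nat list \<Rightarrow> nat \<Rightarrow> com \<Rightarrow> (nat \<Rightarrow> mem \<Rightarrow> bool) \<Rightarrow> nat \<Rightarrow> mem \<Rightarrow> bool"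
where
  "wp N xs L Skip Q t m = Q t m"
| "wp N xs L (Const x n) Q t m = (n \<le> L \<and> Q (t + 22) (m(x := n)))"
| "wp N xs L (Size x) Q t m = (N \<le> L \<and> Q (t + 22) (m(x := N)))"
| "wp N xs L (Read x n) Q t m = (n < length xs \<and> xs ! n \<le> L \<and> Q (t + 22) (m(x := xs ! n)))"
| "wp N xs L (Move x y) Q t m = Q (t + 22) (m(x := m y))"
| "wp N xs L (Plus x y z) Q t m = (m y + m z \<le> L \<and> Q (t + 22) (m(x := m y + m z)))"
| "wp N xs L (Get x j y) Q t m = Q (t + 22) (m(x := m (j, m y)))"
| "wp N xs L (Put j y z) Q t m = Q (t + 22) (m((j, m y) := m z))"
| "wp N xs L (c ;; d) Q t m = wp N xs L c (wp N xs L d Q) t m"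
| "wp N xs L (IfZero x c d) Q t m =
     (if m x = 0 then wp N xs L c Q (t + 4) m else wp N xs L d Q (t + 4) m)"
| "wp N xs L (While x c) Q t m =
     (\<exists>n. ((\<lambda>I t m. m x \<noteq> 0 \<and> wp N xs L c I (t + 4) m) ^^ n) (\<lambda>t m. m x = 0 \<and> Q (t + 4) m) t m)"

lemma wp_mono:
  assumes "wp N xs L c Q t m" "\<And>t m. Q t m \<Longrightarrow> Q' t m"
  shows "wp N xs L c Q' t m"
  using assms
proof (induction c arbitrary: Q Q' t m)
  case (Seq c d)
  from Seq.prems(1) have "wp N xs L c (wp N xs L d Q) t m" by simp
  then have "wp N xs L c (wp N xs L d Q') t m"
    by (rule Seq.IH(1)) (rule Seq.IH(2)[OF _ Seq.prems(2)])
  then show ?case by simp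
next
  case (IfZero x c d)
  then show ?case by (auto split: if_splits)
next
  case (While x c)
  have "((\<lambda>I t m. m x \<noteq> 0 \<and> wp N xs L c I (t + 4) m) ^^ n) (\<lambda>t m. m x = 0 \<and> Q' (t + 4) m) t m"
    if "((\<lambda>I t m. m x \<noteq> 0 \<and> wp N xs L c I (t + 4) m) ^^ n) (\<lambda>t m. m x = 0 \<and> Q (t + 4) m) t m"
    for n t m
    using that
  proof (induction n arbitrary: t m)
    case 0
    then show ?case using While.prems(2) by simp
  next
    case (Suc n)
    then show ?case using While.IH by auto
  qed
  with While.prems(1) show ?case by auto
qed auto

text \<open>\<open>IfZero\<close> and \<open>While\<close> charge 4 steps in advance, but the
  fourth, the closing jump, is executed after the body. This lemma moves that charge across the
  body.\<close>

lemma wp_shift: "wp N xs L c Q (t + k) m = wp N xs L c (\<lambda>t. Q (t + k)) t m"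
proof (induction c arbitrary: Q t m)
  case (While x c)
  have "((\<lambda>I t m. m x \<noteq> 0 \<and> wp N xs L c I (t + 4) m) ^^ n)
          (\<lambda>t m. m x = 0 \<and> Q (t + 4) m) (t + k) m =
        ((\<lambda>I t m. m x \<noteq> 0 \<and> wp N xs L c I (t + 4) m) ^^ n)
          (\<lambda>t m. m x = 0 \<and> Q (t + 4 + k) m) t m" for n
  proof (induction n arbitrary: t m)
    case 0
    then show ?case by (simp add: add_ac)
  next
    case (Suc n)
    then show ?case using While[of _ "t + 4" m] by (simp add: add_ac)
  qed
  then show ?case by (simp add: add_ac)
next
  case (Seq c d)
  show ?case by (simp add: Seq.IH(1)) (simp add: Seq.IH(2)[abs_def])
next
  case (IfZero x c d)
  show ?case
    using IfZero.IH[of _ "t + 4" m] by (simp add: add_ac)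
qed (simp_all add: add_ac)

lemma wp_seqI:
  assumes "wp N xs L c R t m" "\<And>t m. R t m \<Longrightarrow> wp N xs L d Q t m"
  shows "wp N xs L (c ;; d) Q t m"
  using wp_mono[OF assms] by simp

section \<open>Correctness of the compiler\<close>

primrec code_at :: "program \<Rightarrow> nat \<Rightarrow> instr list \<Rightarrow> bool" where
  "code_at P p [] = True"
| "code_at P p (i # is) = (p < length P \<and> P ! p = i \<and> code_at P (Suc p) is)"

lemma code_at_append [simp]:
  "code_at P p (is @ js) \<longleftrightarrow> code_at P p is \<and> code_at P (p + length is) js"
  by (induction "is" arbitrary: p) auto

lemma code_at_middle: "code_at (as @ is @ bs) (length as) is"
proof (induction "is" arbitrary: as)
  case (Cons i "is")
  from Cons[of "as @ [i]"] show ?case by simp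
qed simp

text \<open>\<open>exec\<close> describes complete runs only. A partial run is expressed by what it
  does to them: every complete run from \<open>c'\<close> can be prefixed by \<open>t\<close> steps
  from \<open>c\<close>.\<close>

definition reaches ::
  "program \<Rightarrow> nat \<Rightarrow> nat list \<Rightarrow> nat \<Rightarrow> config \<Rightarrow> nat \<Rightarrow> config \<Rightarrow> bool"
where
  "reaches P N xs M c t c' \<longleftrightarrow>
     (\<forall>k c''. exec P N xs M c' k c'' \<longrightarrow> exec P N xs M c (t + k) c'')"

lemma reaches_refl: "reaches P N xs M c 0 c"
  by (simp add: reaches_def)

lemma reaches_trans:
  "reaches P N xs M c t c' \<Longrightarrow> reaches P N xs M c' t' c'' \<Longrightarrow> reaches P N xs M c (t + t') c''"
  by (simp add: reaches_def add.assoc)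

lemma reaches_step:
  "code_at P (pc c) (i # js) \<Longrightarrow> bounded_by M c \<Longrightarrow> exec_instr N xs i c = Some c' \<Longrightarrow>
   reaches P N xs M c (Suc 0) c'"
  by (auto simp: reaches_def step_def intro: exec.more)

text \<open>Jump-free code as a function, so that blocks are evaluated symbolically. The bound is
  checked before each instruction, as \<open>exec.more\<close> demands; the last configuration is
  left to whatever follows.\<close>

primrec straight ::
  "nat \<Rightarrow> nat list \<Rightarrow> nat \<Rightarrow> instr list \<Rightarrow> config \<Rightarrow> config option"
where
  "straight N xs M [] c = Some c"
| "straight N xs M (i # is) c =
     (if bounded_by M c \<and> (\<forall>l l'. i \<noteq> Jzero l l')
      then Option.bind (exec_instr N xs i c) (straight N xs M is) else None)"

lemma straight_append:
  "straight N xs M (is @ js) c = Option.bind (straight N xs M is c) (straight N xs M js)"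
  by (induction "is" arbitrary: c) (auto split: bind_split)

lemma pc_exec_instr:
  "exec_instr N xs i c = Some c' \<Longrightarrow> \<forall>l l'. i \<noteq> Jzero l l' \<Longrightarrow> pc c' = Suc (pc c)"
  by (cases i) (auto split: if_splits)

lemma straight_reaches:
  assumes "code_at P (pc c) is" "straight N xs M is c = Some c'"
  shows "reaches P N xs M c (length is) c' \<and> pc c' = pc c + length is"
  using assms
proof (induction "is" arbitrary: c)
  case Nil
  then show ?case by (simp add: reaches_refl)
next
  case (Cons i "is")
  from Cons.prems(2) obtain c1 where c1: "exec_instr N xs i c = Some c1"
    "straight N xs M is c1 = Some c'" "bounded_by M c" "\<forall>l l'. i \<noteq> Jzero l l'"
    by (auto split: if_splits bind_splits)
  have pc1: "pc c1 = Suc (pc c)" using pc_exec_instr c1 by blast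
  have "reaches P N xs M c1 (length is) c' \<and> pc c' = pc c1 + length is"
    using Cons.IH[of c1] Cons.prems(1) c1(2) pc1 by simp
  with reaches_trans[OF reaches_step[OF Cons.prems(1) c1(3,1)]] pc1
  show ?case by fastforce
qed

definition mem_of :: "config \<Rightarrow> mem" where
  "mem_of c = (\<lambda>x. reg c (addr x))"

lemma mem_of_simps [simp]:
  "mem_of (c\<lparr>acc := v\<rparr>) = mem_of c"
  "mem_of (c\<lparr>buf := v\<rparr>) = mem_of c"
  "mem_of (c\<lparr>pc := p\<rparr>) = mem_of c"
  "mem_of (c\<lparr>out := ys\<rparr>) = mem_of c"
  "mem_of (c\<lparr>reg := f\<rparr>) = f \<circ> addr"
  by (auto simp: mem_of_def)

lemma straight_fetch:
  assumes "bounded_by M c" "addr x \<le> M"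
  shows "straight N xs M (fetch x) c = Some (c\<lparr>acc := mem_of c x, pc := pc c + 2\<rparr>)"
  using assms by (simp add: fetch_def bounded_by_def mem_of_def)

lemma straight_deposit:
  assumes "bounded_by M c" "addr x \<le> M"
  shows "straight N xs M (deposit x) c =
    Some (c\<lparr>buf := acc c, reg := (reg c)(addr x := acc c), acc := addr x, pc := pc c + 3\<rparr>)"
  using assms by (simp add: deposit_def bounded_by_def)

lemma straight_index:
  assumes "bounded_by M c" "addr (j, acc c) \<le> M"
  shows "straight N xs M (index j) c =
    Some (c\<lparr>acc := addr (j, acc c), buf := 16 * acc c, pc := pc c + 11\<rparr>)"
  using assms by (simp add: index_def bounded_by_def addr_def)

lemma bounded_by_simps:
  "bounded_by M (c\<lparr>acc := v\<rparr>) \<longleftrightarrow> v \<le> M \<and> buf c \<le> M \<and> (\<forall>i. reg c i \<le> M)"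
  "bounded_by M (c\<lparr>buf := v\<rparr>) \<longleftrightarrow> acc c \<le> M \<and> v \<le> M \<and> (\<forall>i. reg c i \<le> M)"
  "bounded_by M (c\<lparr>pc := p\<rparr>) \<longleftrightarrow> bounded_by M c"
  "bounded_by M (c\<lparr>out := ys\<rparr>) \<longleftrightarrow> bounded_by M c"
  "bounded_by M (c\<lparr>reg := f\<rparr>) \<longleftrightarrow> acc c \<le> M \<and> buf c \<le> M \<and> (\<forall>i. f i \<le> M)"
  by (auto simp: bounded_by_def)

lemma addr_le: "snd x \<le> L \<Longrightarrow> addr x \<le> 16 * L + 16"
  using enc_less[of "fst x"] by (simp add: addr_def)

text \<open>Two bounds are needed because accumulator, buffer and scratch register 0 may hold
  addresses, which are about 16 times larger than the values stored in locations.\<close>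

definition good :: "nat \<Rightarrow> nat \<Rightarrow> config \<Rightarrow> bool" where
  "good M L c \<longleftrightarrow> bounded_by M c \<and> (\<forall>x. mem_of c x \<le> L)"

lemma good_goto [simp]: "good M L (goto p c) \<longleftrightarrow> good M L c"
  by (simp add: good_def bounded_by_simps)

text \<open>\<open>t'\<close> is the true number of steps and \<open>T\<close> the number charged by
  \<open>wp\<close>; keeping both allows generous uniform charges.\<close>

definition achieves ::
  "program \<Rightarrow> nat \<Rightarrow> nat list \<Rightarrow> nat \<Rightarrow> nat \<Rightarrow> config \<Rightarrow> nat \<Rightarrow> (nat \<Rightarrow> mem \<Rightarrow> bool) \<Rightarrow> nat \<Rightarrow> bool"
where
  "achieves P N xs M L c t Q p \<longleftrightarrow>
     (\<exists>t' T c'. reaches P N xs M c t' c' \<and> t' \<le> T \<and> Q (t + T) (mem_of c') \<and> pc c' = p \<and>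
        good M L c' \<and> out c' = out c)"

text \<open>22 is the length of \<open>Put\<close>, the longest atomic statement; every atomic
  statement is charged this amount.\<close>

lemma achieves_straight:
  assumes "code_at P (pc c) is" "straight N xs M is c = Some c'"
    "good M L c'" "out c' = out c" "Q (t + 22) (mem_of c')" "length is \<le> 22" "p = pc c + length is"
  shows "achieves P N xs M L c t Q p"
  using straight_reaches[OF assms(1,2)] assms(3-) unfolding achieves_def by blast

lemma achieves_after:
  assumes "reaches P N xs M c t1 c1" "t1 \<le> T1" "achieves P N xs M L c1 (t + T1) Q p" "out c1 = out c"
  shows "achieves P N xs M L c t Q p"
proof -
  from assms(3) obtain t' T c' where *: "reaches P N xs M c1 t' c'" "t' \<le> T"
    "Q (t + T1 + T) (mem_of c')" "pc c' = p" "good M L c'" "out c' = out c1"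
    unfolding achieves_def by blast
  show ?thesis unfolding achieves_def
    using reaches_trans[OF assms(1) *(1)] * assms(2,4)
    by (intro exI[of _ "t1 + t'"] exI[of _ "T1 + T"] exI[of _ c']) (simp add: add.assoc)
qed

lemma achieves_trans:
  assumes "achieves P N xs M L c t R p"
    "\<And>t' c'. R t' (mem_of c') \<Longrightarrow> pc c' = p \<Longrightarrow> good M L c' \<Longrightarrow> achieves P N xs M L c' t' Q q"
  shows "achieves P N xs M L c t Q q"
proof -
  from assms(1) obtain t' T c' where *: "reaches P N xs M c t' c'" "t' \<le> T"
    "R (t + T) (mem_of c')" "pc c' = p" "good M L c'" "out c' = out c"
    unfolding achieves_def by blast
  show ?thesis
    using achieves_after[OF *(1,2) assms(2)[OF *(3,4,5)] *(6)] .
qed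

lemma achieves_Jzero:
  assumes "code_at P (pc c) [Jzero p p]" "good M L c" "Q (Suc t) (mem_of c)"
  shows "achieves P N xs M L c t Q p"
proof -
  have "reaches P N xs M c (Suc 0) (goto p c)"
    using assms(2) by (intro reaches_step[OF assms(1)]) (auto simp: good_def)
  then show ?thesis
    unfolding achieves_def using assms(2,3)
    by (intro exI[of _ "Suc 0"] exI[of _ "goto p c"]) simp
qed

lemma reaches_test:
  assumes "code_at P (pc c) (fetch x @ [Jzero p q])" "good M L c" "addr x \<le> M"
  shows "\<exists>c'. reaches P N xs M c 3 c' \<and> good M L c' \<and> mem_of c' = mem_of c \<and> out c' = out c \<and>
    pc c' = (if mem_of c x = 0 then p else q)"
proof -
  let ?c = "c\<lparr>acc := mem_of c x, pc := pc c + 2\<rparr>"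
  let ?c' = "goto (if mem_of c x = 0 then p else q) ?c"
  have b: "bounded_by M c" using assms(2) by (simp add: good_def)
  have "reaches P N xs M c (length (fetch x)) ?c"
    using straight_reaches[OF _ straight_fetch[OF b assms(3)]] assms(1) by simp
  then have r1: "reaches P N xs M c 2 ?c" by (simp add: fetch_def eval_nat_numeral)
  have b': "bounded_by M ?c" using b by (auto simp: bounded_by_def mem_of_def)
  have "reaches P N xs M ?c (Suc 0) ?c'"
    using assms(1) by (intro reaches_step[OF _ b', where i = "Jzero p q" and js = "[]"])
      (auto simp: fetch_def)
  from reaches_trans[OF r1 this] have "reaches P N xs M c 3 ?c'"
    by (simp add: numeral_3_eq_3)
  moreover have "good M L ?c'" using assms(2) b' by (simp add: good_def bounded_by_simps)
  ultimately show ?thesis by (intro exI[of _ ?c']) simp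
qed

lemma code_at_set: "code_at P p is \<Longrightarrow> set is \<subseteq> set P"
  by (induction "is" arbitrary: p) auto

text \<open>Fixed addresses occur in the code as constants and are bounded through
  \<open>imm\<close>. The addresses computed by \<open>Get\<close> and \<open>Put\<close> come from
  values at most \<open>L\<close>, so \<open>16 * L + 16 \<le> M\<close> covers them.\<close>

lemma compile_correct:
  assumes imm: "\<And>j. Cst j \<in> set P \<Longrightarrow> j \<le> M" and M: "16 * L + 16 \<le> M"
  assumes "code_at P (pc c) (compile (pc c) cm)" "good M L c" "wp N xs L cm Q t (mem_of c)"
  shows "achieves P N xs M L c t Q (pc c + csize cm)"
  using assms(3-)
proof (induction cm arbitrary: c t Q)
  case Skip
  then show ?case
    unfolding achieves_def
    by (intro exI[of _ 0] exI[of _ 0] exI[of _ c]) (simp add: reaches_refl)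
next
  case (Const x n)
  have "addr x \<le> M" "n \<le> M"
    using code_at_set[OF Const.prems(1)] imm by (auto simp: deposit_def)
  with Const show ?case
    by (intro achieves_straight[OF Const.prems(1)],
      simp add: good_def bounded_by_simps bounded_by_def[of M c] straight_append straight_fetch
        straight_deposit straight_index mem_of_def)
      (auto simp: good_def bounded_by_simps bounded_by_def[of M c] fetch_def index_def deposit_def
        mem_of_def o_def fun_upd_def add.commute cong: if_cong
        simp del: split_paired_All)
next
  case (Size x)
  have "addr x \<le> M"
    using code_at_set[OF Size.prems(1)] imm by (auto simp: deposit_def)
  with Size M show ?case
    by (intro achieves_straight[OF Size.prems(1)],
      simp add: good_def bounded_by_simps bounded_by_def[of M c] straight_append straight_fetch
        straight_deposit straight_index mem_of_def)
      (auto simp: good_def bounded_by_simps bounded_by_def[of M c] fetch_def index_def deposit_def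
        mem_of_def o_def fun_upd_def add.commute cong: if_cong
        simp del: split_paired_All)
next
  case (Read x n)
  have "addr x \<le> M" "n \<le> M"
    using code_at_set[OF Read.prems(1)] imm by (auto simp: deposit_def)
  with Read M show ?case
    by (intro achieves_straight[OF Read.prems(1)],
      simp add: good_def bounded_by_simps bounded_by_def[of M c] straight_append straight_fetch
        straight_deposit straight_index mem_of_def)
      (auto simp: good_def bounded_by_simps bounded_by_def[of M c] fetch_def index_def deposit_def
        mem_of_def o_def fun_upd_def add.commute cong: if_cong
        simp del: split_paired_All)
next
  case (Move x y)
  have "addr x \<le> M" "addr y \<le> M"
    using code_at_set[OF Move.prems(1)] imm by (auto simp: deposit_def fetch_def)
  with Move M show ?case
    by (intro achieves_straight[OF Move.prems(1)],
      simp add: good_def bounded_by_simps bounded_by_def[of M c] straight_append straight_fetch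
        straight_deposit straight_index mem_of_def)
      (auto simp: good_def bounded_by_simps bounded_by_def[of M c] fetch_def index_def deposit_def
        mem_of_def o_def fun_upd_def add.commute cong: if_cong
        simp del: split_paired_All)
next
  case (Plus x y z)
  have "addr x \<le> M" "addr y \<le> M" "addr z \<le> M"
    using code_at_set[OF Plus.prems(1)] imm by (auto simp: deposit_def fetch_def)
  moreover have "mem_of c y + mem_of c z \<le> M" using Plus M by simp
  ultimately show ?case using Plus M
    by (intro achieves_straight[OF Plus.prems(1)],
      simp add: good_def bounded_by_simps bounded_by_def[of M c] straight_append straight_fetch
        straight_deposit straight_index mem_of_def)
      (auto simp: good_def bounded_by_simps bounded_by_def[of M c] fetch_def index_def deposit_def
        mem_of_def o_def fun_upd_def add.commute cong: if_cong
        simp del: split_paired_All)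
next
  case (Get x j y)
  have "addr x \<le> M" "addr y \<le> M"
    using code_at_set[OF Get.prems(1)] imm by (auto simp: deposit_def fetch_def)
  moreover have "addr (j, mem_of c y) \<le> M"
    using addr_le[of "(j, mem_of c y)" L] Get.prems(2) M
    by (auto simp: good_def simp del: split_paired_All intro: order_trans)
  moreover from this have "16 * mem_of c y \<le> M" by (simp add: addr_def)
  ultimately show ?case using Get M
    by (intro achieves_straight[OF Get.prems(1)],
      simp add: good_def bounded_by_simps bounded_by_def[of M c] straight_append straight_fetch
        straight_deposit straight_index mem_of_def)
      (auto simp: good_def bounded_by_simps bounded_by_def[of M c] fetch_def index_def deposit_def
        mem_of_def o_def fun_upd_def add.commute cong: if_cong
        simp del: split_paired_All)
next
  case (Put j y z)
  have "addr y \<le> M" "addr z \<le> M"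
    using code_at_set[OF Put.prems(1)] imm by (auto simp: deposit_def fetch_def)
  moreover have "addr (j, mem_of c y) \<le> M"
    using addr_le[of "(j, mem_of c y)" L] Put.prems(2) M
    by (auto simp: good_def simp del: split_paired_All intro: order_trans)
  moreover from this have "16 * mem_of c y \<le> M" by (simp add: addr_def)
  ultimately show ?case using Put M
    by (intro achieves_straight[OF Put.prems(1)],
      simp add: good_def bounded_by_simps bounded_by_def[of M c] straight_append straight_fetch
        straight_deposit straight_index mem_of_def)
      (auto simp: good_def bounded_by_simps bounded_by_def[of M c] fetch_def index_def deposit_def
        mem_of_def o_def fun_upd_def add.commute cong: if_cong
        simp del: split_paired_All)
next
  case (Seq c1 c2)
  show ?case
  proof (rule achieves_trans)
    show "achieves P N xs M L c t (wp N xs L c2 Q) (pc c + csize c1)"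
      using Seq.prems by (intro Seq.IH) auto
  next
    fix t' c'
    assume "wp N xs L c2 Q t' (mem_of c')" "pc c' = pc c + csize c1" "good M L c'"
    then show "achieves P N xs M L c' t' Q (pc c + csize (c1 ;; c2))"
      using Seq.IH(2)[of c' Q t'] Seq.prems(1) by (simp add: add.assoc)
  qed
next
  case (IfZero x c1 c2)
  let ?p = "pc c"
  have x: "addr x \<le> M"
    using code_at_set[OF IfZero.prems(1)] imm by (auto simp: fetch_def)
  have test: "code_at P (pc c) (fetch x @ [Jzero (?p + 3) (?p + csize c1 + 4)])"
    using IfZero.prems(1) by (simp add: fetch_def)
  from reaches_test[OF test IfZero.prems(2) x] obtain c' where c':
    "reaches P N xs M c 3 c'" "good M L c'" "mem_of c' = mem_of c" "out c' = out c"
    "pc c' = (if mem_of c x = 0 then ?p + 3 else ?p + csize c1 + 4)" by blast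
  show ?case
  proof (cases "mem_of c x = 0")
    case True
    show ?thesis
    proof (rule achieves_after[OF c'(1) order_refl _ c'(4)])
      show "achieves P N xs M L c' (t + 3) Q (?p + csize (IfZero x c1 c2))"
      proof (rule achieves_trans)
        show "achieves P N xs M L c' (t + 3) (\<lambda>t. Q (Suc t)) (pc c' + csize c1)"
        proof (rule IfZero.IH(1))
          show "wp N xs L c1 (\<lambda>t. Q (Suc t)) (t + 3) (mem_of c')"
            using IfZero.prems(3) wp_shift[where c = c1 and Q = Q and t = "t + 3" and k = 1] True c'
            by (simp add: eval_nat_numeral)
        qed (use IfZero.prems(1) c' True in \<open>simp_all add: fetch_def eval_nat_numeral\<close>)
      next
        fix t'' c''
        assume "Q (Suc t'') (mem_of c'')" "pc c'' = pc c' + csize c1" "good M L c''"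
        then show "achieves P N xs M L c'' t'' Q (?p + csize (IfZero x c1 c2))"
          using IfZero.prems(1) c' True
          by (intro achieves_Jzero) (simp_all add: fetch_def eval_nat_numeral)
      qed
    qed
  next
    case False
    show ?thesis
    proof (rule achieves_after[OF c'(1) _ _ c'(4)])
      \<comment> \<open>The second branch runs straight into the end of the statement, without the
        closing jump that was charged.\<close>
      show "3 \<le> (4 :: nat)" by simp
      have "achieves P N xs M L c' (t + 4) Q (pc c' + csize c2)"
        using IfZero.prems c' False
        by (intro IfZero.IH(2)) (simp_all add: fetch_def eval_nat_numeral)
      then show "achieves P N xs M L c' (t + 4) Q (?p + csize (IfZero x c1 c2))"
        using c' False by (simp add: add_ac)
    qed
  qed
next
  case (While x cb)
  let ?step = "\<lambda>I t m. m x \<noteq> 0 \<and> wp N xs L cb I (t + 4) m"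
  let ?done = "\<lambda>t m. m x = 0 \<and> Q (t + 4) m"
  let ?p = "pc c"
  let ?q = "?p + csize (While x cb)"
  have x: "addr x \<le> M"
    using code_at_set[OF While.prems(1)] imm by (auto simp: fetch_def)
  have "achieves P N xs M L c t Q ?q"
    if "(?step ^^ n) ?done t (mem_of c)" "pc c = ?p" "good M L c" for n c t
    using that
  proof (induction n arbitrary: c t)
    case 0
    have test: "code_at P (pc c) (fetch x @ [Jzero ?q (?p + 3)])"
      using While.prems(1) 0 by (simp add: fetch_def)
    from reaches_test[OF test 0(3) x] 0 obtain c' where c':
      "reaches P N xs M c 3 c'" "good M L c'" "mem_of c' = mem_of c" "out c' = out c" "pc c' = ?q"
      by auto
    \<comment> \<open>Leaving the loop takes only fetch and test, 3 of the 4 steps charged.\<close>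
    then show ?case
      unfolding achieves_def using 0
      by (intro exI[of _ 3] exI[of _ 4] exI[of _ c']) simp
  next
    case (Suc n)
    have test: "code_at P (pc c) (fetch x @ [Jzero ?q (?p + 3)])"
      using While.prems(1) Suc.prems by (simp add: fetch_def)
    from reaches_test[OF test Suc.prems(3) x] Suc.prems obtain c' where c':
      "reaches P N xs M c 3 c'" "good M L c'" "mem_of c' = mem_of c" "out c' = out c"
      "pc c' = ?p + 3" by auto
    show ?case
    proof (rule achieves_after[OF c'(1) order_refl _ c'(4)], rule achieves_trans)
      let ?R = "(?step ^^ n) ?done"
      have "wp N xs L cb (\<lambda>t. ?R (Suc t)) (t + 3) (mem_of c')"
        using Suc.prems wp_shift[where c = cb and Q = ?R and t = "t + 3" and k = 1] c'
        by (simp add: eval_nat_numeral)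
      then show "achieves P N xs M L c' (t + 3) (\<lambda>t. ?R (Suc t)) (pc c' + csize cb)"
        using While.prems(1) c'
        by (intro While.IH) (simp_all add: fetch_def eval_nat_numeral)
    next
      fix t'' c''
      assume *: "((?step ^^ n) ?done) (Suc t'') (mem_of c'')" "pc c'' = pc c' + csize cb" "good M L c''"
      have "reaches P N xs M c'' (Suc 0) (goto ?p c'')"
        using While.prems(1) c' *
        by (intro reaches_step[where i = "Jzero ?p ?p" and js = "[]"]) (simp_all add: fetch_def good_def eval_nat_numeral)
      then show "achieves P N xs M L c'' t'' Q ?q"
        by (rule achieves_after[where ?T1.0 = 1]) (use * Suc.IH[of "Suc t''" "goto ?p c''"] in simp_all)
    qed
  qed
  with While.prems(2,3) show ?case by auto
qed

section \<open>Digit vectors and their arithmetic\<close>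

text \<open>A loop unrolled at compile time: \<open>n\<close> will depend on \<open>d\<close> only,
  so one program serves every \<open>N\<close>.\<close>

primrec rep :: "nat \<Rightarrow> (nat \<Rightarrow> com) \<Rightarrow> com" where
  "rep 0 f = Skip"
| "rep (Suc n) f = rep n f ;; f n"

text \<open>Time is absent from the invariant; for unrolled code it is added afterwards by
  \<open>wp_cost\<close>.\<close>

lemma wp_rep:
  assumes "I 0 m"
    and "\<And>i t m. i < n \<Longrightarrow> I i m \<Longrightarrow> wp N xs L (f i) (\<lambda>_. I (Suc i)) t m"
  shows "wp N xs L (rep n f) (\<lambda>_. I n) t m"
proof -
  have "k \<le> n \<Longrightarrow> wp N xs L (rep k f) (\<lambda>_. I k) t m" for k
  proof (induction k)
    case (Suc k)
    then have "wp N xs L (rep k f) (\<lambda>_. I k) t m" by simp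
    then have "wp N xs L (rep k f ;; f k) (\<lambda>_. I (Suc k)) t m"
      by (rule wp_seqI) (use Suc.prems assms(2) in simp)
    then show ?case by simp
  qed (simp add: assms(1))
  then show ?thesis by simp
qed

section \<open>Frame conditions, table contents and positional notation\<close>

definition unch :: "col set \<Rightarrow> mem \<Rightarrow> mem \<Rightarrow> bool" where
  "unch C m m' \<longleftrightarrow> (\<forall>j i. j \<notin> C \<longrightarrow> m' (j, i) = m (j, i))"

lemma unch_refl [simp]: "unch C m m"
  by (simp add: unch_def)

lemma unch_upd [simp]: "fst x \<in> C \<Longrightarrow> unch C m (m'(x := v)) \<longleftrightarrow> unch C m m'"
  by (cases x) (auto simp: unch_def)

lemma unch_trans: "unch C m m' \<Longrightarrow> unch D m' m'' \<Longrightarrow> C \<union> D \<subseteq> E \<Longrightarrow> unch E m m''"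
  unfolding unch_def by (metis UnCI subsetD)

lemma unch_mono: "unch C m m' \<Longrightarrow> C \<subseteq> E \<Longrightarrow> unch E m m'"
  by (auto simp: unch_def)

lemma unchD: "unch C m m' \<Longrightarrow> fst x \<notin> C \<Longrightarrow> m' x = m x"
  by (cases x) (auto simp: unch_def)

text \<open>\<open>TRow\<close> lets a two-digit index be formed by one addition, and
  \<open>Glob\<close> provides the largest digit for complements. Row \<open>y\<close> of
  \<open>TQuo\<close> is specified only up to \<open>x = y\<close>, which suffices because the
  leading digit of the scaled remainder never exceeds that of the scaled divisor.\<close>

definition tables :: "nat \<Rightarrow> mem \<Rightarrow> bool" where
  "tables \<beta> m \<longleftrightarrow>
     m (Glob, 0) = \<beta> - 1 \<and>
     (\<forall>v < \<beta> * \<beta>. m (THi, v) = v div \<beta> \<and> m (TLo, v) = v mod \<beta>) \<and>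
     (\<forall>x < \<beta>. \<forall>y < \<beta>. m (TMul, \<beta> * x + y) = x * y) \<and>
     (\<forall>x < \<beta>. m (TRow, x) = \<beta> * x) \<and>
     (\<forall>y < \<beta>. \<forall>x \<le> y. m (TQuo, \<beta> * y + x) = \<beta> * x div Suc y)"

definition work_cols :: "col set" where
  "work_cols = {Tmp, Norm, ColA, ColB, ColR, ColW, ColX, ColQ}"

lemma tables_unch:
  assumes "tables \<beta> m" "unch C m m'" "C \<subseteq> work_cols"
  shows "tables \<beta> m'"
proof -
  have "m' x = m x" if "fst x \<in> {Glob, THi, TLo, TMul, TRow, TQuo}" for x
    using that assms(3) by (intro unchD[OF assms(2)]) (auto simp: work_cols_def)
  then show ?thesis using assms(1) by (simp add: tables_def)
qed

definition val :: "nat \<Rightarrow> mem \<Rightarrow> col \<Rightarrow> nat \<Rightarrow> nat" where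
  "val \<beta> m j n = (\<Sum>i<n. m (j, i) * \<beta> ^ i)"

lemma val_0 [simp]: "val \<beta> m j 0 = 0"
  by (simp add: val_def)

lemma val_Suc [simp]: "val \<beta> m j (Suc n) = val \<beta> m j n + m (j, n) * \<beta> ^ n"
  by (simp add: val_def)

lemma val_upd_other [simp]: "fst x \<noteq> j \<Longrightarrow> val \<beta> (m(x := v)) j n = val \<beta> m j n"
  by (auto simp: val_def intro!: sum.cong)

lemma val_upd_ge [simp]: "n \<le> i \<Longrightarrow> val \<beta> (m((j, i) := v)) j n = val \<beta> m j n"
  by (auto simp: val_def intro!: sum.cong)

lemma val_cong: "(\<And>i. i < n \<Longrightarrow> m (j, i) = m' (k, i)) \<Longrightarrow> val \<beta> m j n = val \<beta> m' k n"
  by (auto simp: val_def intro!: sum.cong)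

definition holds :: "nat \<Rightarrow> mem \<Rightarrow> col \<Rightarrow> nat \<Rightarrow> nat \<Rightarrow> bool" where
  "holds \<beta> m j n x \<longleftrightarrow> (\<forall>i<n. m (j, i) < \<beta>) \<and> val \<beta> m j n = x"

lemma holds_cong:
  assumes "\<And>i. i < n \<Longrightarrow> m' (k, i) = m (j, i)"
  shows "holds \<beta> m' k n x \<longleftrightarrow> holds \<beta> m j n x"
  using assms val_cong[of n m' k m j \<beta>] by (auto simp: holds_def)

lemma holds_unch: "holds \<beta> m j n x \<Longrightarrow> unch C m m' \<Longrightarrow> j \<notin> C \<Longrightarrow> holds \<beta> m' j n x"
  using holds_cong[of n m' j m j] by (simp add: unchD)

lemma val_less: "(\<And>i. i < n \<Longrightarrow> m (j, i) < \<beta>) \<Longrightarrow> val \<beta> m j n < \<beta> ^ n"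
proof (induction n)
  case (Suc n)
  have "val \<beta> m j n + m (j, n) * \<beta> ^ n < \<beta> ^ n + m (j, n) * \<beta> ^ n"
    using Suc by simp
  also have "\<dots> \<le> \<beta> * \<beta> ^ n"
    using mult_right_mono[of "Suc (m (j, n))" \<beta> "\<beta> ^ n"] Suc.prems[of n] by simp
  finally show ?case by simp
qed simp

text \<open>Uniqueness of the representation by proper digits; it links register contents to the
  \<open>div\<close>/\<open>mod\<close> form used for input and output.\<close>

lemma holds_digit:
  assumes "holds \<beta> m j n x" "i < n"
  shows "x div \<beta> ^ i mod \<beta> = m (j, i)"
proof -
  have "k \<le> n \<Longrightarrow> i < k \<Longrightarrow> val \<beta> m j k div \<beta> ^ i mod \<beta> = m (j, i)" for k
  proof (induction k)
    case (Suc k)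
    from Suc.prems assms(1) have pos: "0 < \<beta>" by (fastforce simp: holds_def)
    show ?case
    proof (cases "i = k")
      case True
      have "val \<beta> m j k < \<beta> ^ k"
        using Suc.prems assms(1) by (intro val_less) (auto simp: holds_def)
      then show ?thesis using True Suc.prems assms(1) pos by (simp add: holds_def)
    next
      case False
      then obtain e where e: "k = i + Suc e"
        using Suc.prems less_imp_Suc_add[of i k] by auto
      \<comment> \<open>A digit above position \<open>i\<close> contributes a multiple of
        \<open>\<beta> ^ Suc i\<close> and so does not affect digit \<open>i\<close>.\<close>
      have "val \<beta> m j (Suc k) = val \<beta> m j k + \<beta> ^ i * (\<beta> * (m (j, k) * \<beta> ^ e))"
        by (simp add: e power_add)
      also have "\<dots> div \<beta> ^ i = \<beta> * (m (j, k) * \<beta> ^ e) + val \<beta> m j k div \<beta> ^ i"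
        by (rule div_mult_self2) (use pos in simp)
      finally have "val \<beta> m j (Suc k) div \<beta> ^ i mod \<beta> = val \<beta> m j k div \<beta> ^ i mod \<beta>"
        by (simp only: mod_mult_self4)
      then show ?thesis using Suc False by simp
    qed
  qed simp
  from this[of n] assms show ?thesis by (simp add: holds_def)
qed

text \<open>\<open>Tmp 0\<close> keeps the row of the multiplier, fetched once, and
  \<open>Tmp 1\<close> the carry. The last carry is dropped, so the product has to fit into
  \<open>n\<close> digits.\<close>

definition mulc :: "col \<Rightarrow> loc \<Rightarrow> col \<Rightarrow> nat \<Rightarrow> com" where
  "mulc dst x src n = Get (Tmp, 0) TRow x ;; Const (Tmp, 1) 0 ;;
     rep n (\<lambda>i. Plus (Tmp, 2) (Tmp, 0) (src, i) ;; Get (Tmp, 2) TMul (Tmp, 2) ;;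
       Plus (Tmp, 2) (Tmp, 2) (Tmp, 1) ;; Get (dst, i) TLo (Tmp, 2) ;; Get (Tmp, 1) THi (Tmp, 2))"

text \<open>
  Subtraction adds the digitwise complement with an initial carry of 1, so the final carry is nonzero
  iff nothing was borrowed.  The complement of \<open>y\<close> is the low digit of
  \<open>y * (\<beta> - 1) + (\<beta> - 1) = \<beta> * y + (\<beta> - 1 - y)\<close>.
\<close>

definition subc :: "col \<Rightarrow> col \<Rightarrow> col \<Rightarrow> nat \<Rightarrow> com" where
  "subc dst a b n = Const (Tmp, 1) 1 ;;
     rep n (\<lambda>i. Get (Tmp, 2) TRow (b, i) ;; Plus (Tmp, 2) (Tmp, 2) (Glob, 0) ;;
       Get (Tmp, 2) TMul (Tmp, 2) ;; Plus (Tmp, 2) (Tmp, 2) (Glob, 0) ;;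
       Get (Tmp, 2) TLo (Tmp, 2) ;; Plus (Tmp, 2) (Tmp, 2) (a, i) ;;
       Plus (Tmp, 2) (Tmp, 2) (Tmp, 1) ;; Get (dst, i) TLo (Tmp, 2) ;; Get (Tmp, 1) THi (Tmp, 2))"

definition copyc :: "col \<Rightarrow> col \<Rightarrow> nat \<Rightarrow> com" where
  "copyc dst src n = rep n (\<lambda>i. Move (dst, i) (src, i))"

text \<open>Long numbers cannot be compared directly. The difference is formed in
  \<open>ColX\<close> and replaces the remainder only if the final carry shows that nothing was
  borrowed. The same code subtracts the multiple given by the trial digit and makes the unit
  corrections.\<close>

definition refine :: "loc \<Rightarrow> nat \<Rightarrow> nat \<Rightarrow> com" where
  "refine x i n = mulc ColW x ColB n ;; subc ColX ColR ColW n ;;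
     IfZero (Tmp, 1) Skip (copyc ColR ColX n ;; Plus (ColQ, i) (ColQ, i) x)"

text \<open>When \<beta> is \<open>base N\<close> with \<open>0 < N\<close>, the bound
  \<open>2 \<le> \<beta>\<close> excludes just \<open>N = 1\<close>, where no \<open>b\<close> with
  \<open>0 < b < N ^ d\<close> exists. The bound on \<open>L\<close> allows every two-digit index to
  be stored as a value.\<close>

locale radix =
  fixes N :: nat and xs :: "nat list" and L \<beta> :: nat
  assumes base_ge: "2 \<le> \<beta>" and sq_le: "\<beta> * \<beta> \<le> L"
begin

lemma base_pos: "0 < \<beta>"
  using base_ge by simp

lemma less_sq: "v div \<beta> < \<beta> \<Longrightarrow> v < \<beta> * \<beta>"
  using base_pos by (simp add: div_less_iff_less_mult)

lemma pair_less: "x < \<beta> \<Longrightarrow> y < \<beta> \<Longrightarrow> \<beta> * x + y < \<beta> * \<beta>"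
  by (rule less_sq) simp

lemma prod_less:
  assumes "x < \<beta>" "y < \<beta>" "z < \<beta>"
  shows "x * y + z < \<beta> * \<beta>"
proof -
  have "x * y \<le> \<beta> * x" using assms by simp
  with pair_less[OF assms(1,3)] show ?thesis by linarith
qed

lemma wp_mulc:
  assumes tab: "tables \<beta> m" and e: "m x < \<beta>" and src: "holds \<beta> m src n u"
    and cols: "dst \<in> work_cols" "dst \<noteq> Tmp" "src \<in> work_cols" "src \<noteq> Tmp" "dst \<noteq> src"
    and fits: "m x * u < \<beta> ^ n"
  shows "wp N xs L (mulc dst x src n)
    (\<lambda>_ m'. unch {Tmp, dst} m m' \<and> holds \<beta> m' dst n (m x * u)) t m"
proof -
  define I where "I i m' \<longleftrightarrow> unch {Tmp, dst} m m' \<and> m' (Tmp, 0) = \<beta> * m x \<and> m' (Tmp, 1) < \<beta> \<and>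
    (\<forall>j<i. m' (dst, j) < \<beta>) \<and> val \<beta> m' dst i + m' (Tmp, 1) * \<beta> ^ i = m x * val \<beta> m src i"
    for i m'
  have body: "wp N xs L (Plus (Tmp, 2) (Tmp, 0) (src, i) ;; Get (Tmp, 2) TMul (Tmp, 2) ;;
       Plus (Tmp, 2) (Tmp, 2) (Tmp, 1) ;; Get (dst, i) TLo (Tmp, 2) ;; Get (Tmp, 1) THi (Tmp, 2))
       (\<lambda>_. I (Suc i)) t m'"
    if i: "i < n" and I: "I i m'" for i t m'
  proof -
    define s where "s = m (src, i)"
    define c where "c = m' (Tmp, 1)"
    define v where "v = m x * s + c"
    have un: "unch {Tmp, dst} m m'" and c: "c < \<beta>" and s: "s < \<beta>"
      using I i src by (auto simp: I_def c_def s_def holds_def)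
    have tab': "tables \<beta> m'"
      using tables_unch[OF tab un] cols by (auto simp: work_cols_def)
    have s': "m' (src, i) = s"
      using unchD[OF un, of "(src, i)"] cols by (simp add: s_def)
    have v: "v < \<beta> * \<beta>" using prod_less[OF e s c] by (simp add: v_def)
    have p: "\<beta> * m x + s < \<beta> * \<beta>" using pair_less[OF e s] .
    have look: "m' (TMul, \<beta> * m x + s) = m x * s" "m' (TLo, v) = v mod \<beta>" "m' (THi, v) = v div \<beta>"
      using tab' e s v by (auto simp: tables_def)
    have "v mod \<beta> * \<beta> ^ i + v div \<beta> * (\<beta> * \<beta> ^ i) = v * \<beta> ^ i"
      by (metis add_mult_distrib div_mult_mod_eq add.commute mult.assoc mult.commute)
    then have "val \<beta> m' dst i + v mod \<beta> * \<beta> ^ i + v div \<beta> * (\<beta> * \<beta> ^ i) =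
      m x * (val \<beta> m src i + s * \<beta> ^ i)"
      using I by (simp add: I_def v_def c_def algebra_simps)
    moreover have "dst \<noteq> Tmp" "TMul \<noteq> dst" "TLo \<noteq> dst" "THi \<noteq> dst" "m' (Tmp, 0) = \<beta> * m x"
      using cols I by (auto simp: work_cols_def I_def)
    moreover have "v div \<beta> < \<beta>" using v by (simp add: less_mult_imp_div_less)
    ultimately show ?thesis
      using I i cols v p s' look sq_le base_pos
      by (auto simp: I_def v_def c_def s_def less_Suc_eq)
  qed
  have init: "I 0 (m((Tmp, 0) := \<beta> * m x, (Tmp, 1) := 0))"
    using base_pos by (simp add: I_def)
  have fin: "unch {Tmp, dst} m m' \<and> holds \<beta> m' dst n (m x * u)" if "I n m'" for m'
  proof -
    have eq: "val \<beta> m' dst n + m' (Tmp, 1) * \<beta> ^ n = m x * u"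
      using that src by (simp add: I_def holds_def)
    \<comment> \<open>A nonzero carry would contribute at least \<open>\<beta> ^ n\<close>.\<close>
    with fits have "m' (Tmp, 1) = 0" by (cases "m' (Tmp, 1)") auto
    with eq that show ?thesis by (simp add: I_def holds_def)
  qed
  have row: "m (TRow, m x) = \<beta> * m x" using tab e by (simp add: tables_def)
  show ?thesis
    unfolding mulc_def wp.simps row
    by (intro conjI wp_mono[OF wp_rep[where I = I, OF init body] fin]) simp
qed

lemma wp_subc:
  assumes tab: "tables \<beta> m" and a: "holds \<beta> m ca n a" and b: "holds \<beta> m cb n b"
    and cols: "dst \<in> work_cols" "dst \<noteq> Tmp" "ca \<in> work_cols" "ca \<noteq> Tmp" "ca \<noteq> dst"
      "cb \<in> work_cols" "cb \<noteq> Tmp" "cb \<noteq> dst"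
  shows "wp N xs L (subc dst ca cb n)
    (\<lambda>_ m'. unch {Tmp, dst} m m' \<and>
       (if b \<le> a then m' (Tmp, 1) \<noteq> 0 \<and> holds \<beta> m' dst n (a - b) else m' (Tmp, 1) = 0)) t m"
proof -
  \<comment> \<open>On the first \<open>i\<close> digits, complement and initial carry give
    \<open>a + (\<beta> ^ i - 1 - b) + 1\<close>; moving \<open>b\<close> to the left side avoids
    truncated subtraction.\<close>
  define I where "I i m' \<longleftrightarrow> unch {Tmp, dst} m m' \<and> m' (Tmp, 1) \<le> 1 \<and> (\<forall>j<i. m' (dst, j) < \<beta>) \<and>
    val \<beta> m' dst i + m' (Tmp, 1) * \<beta> ^ i + val \<beta> m cb i = val \<beta> m ca i + \<beta> ^ i"
    for i m'
  have body: "wp N xs L (Get (Tmp, 2) TRow (cb, i) ;; Plus (Tmp, 2) (Tmp, 2) (Glob, 0) ;;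
       Get (Tmp, 2) TMul (Tmp, 2) ;; Plus (Tmp, 2) (Tmp, 2) (Glob, 0) ;;
       Get (Tmp, 2) TLo (Tmp, 2) ;; Plus (Tmp, 2) (Tmp, 2) (ca, i) ;;
       Plus (Tmp, 2) (Tmp, 2) (Tmp, 1) ;; Get (dst, i) TLo (Tmp, 2) ;; Get (Tmp, 1) THi (Tmp, 2))
       (\<lambda>_. I (Suc i)) t m'"
    if i: "i < n" and I: "I i m'" for i t m'
  proof -
    define x where "x = m (ca, i)"
    define y where "y = m (cb, i)"
    define l where "l = \<beta> - 1"
    define c where "c = m' (Tmp, 1)"
    define z where "z = l - y"
    define v where "v = z + x + c"
    have un: "unch {Tmp, dst} m m'" and c: "c \<le> 1" and x: "x < \<beta>" and y: "y < \<beta>"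
      using I i a b by (auto simp: I_def c_def x_def y_def holds_def)
    have tab': "tables \<beta> m'"
      using tables_unch[OF tab un] cols by (auto simp: work_cols_def)
    have xy': "m' (ca, i) = x" "m' (cb, i) = y"
      using unchD[OF un] cols by (simp_all add: x_def y_def)
    have last: "l < \<beta>" "\<beta> = Suc l" using base_pos by (simp_all add: l_def)
    have z: "z < \<beta>" "z + y = l" using y by (auto simp: z_def l_def)
    \<comment> \<open>Two digits and a carry; base at least 2 makes this sum a legitimate index of
      \<open>TLo\<close> and \<open>THi\<close>.\<close>
    have "v < 2 * \<beta>" using z(1) x c by (simp add: v_def)
    then have v: "v < \<beta> * \<beta>" using base_ge mult_right_mono[of 2 \<beta> \<beta>] by linarith
    have p: "\<beta> * y + (l) < \<beta> * \<beta>" using pair_less[OF y last(1)] .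
    have "y * (l) + y = \<beta> * y"
      using last(2) by simp
    then have neg: "y * (l) + (l) = \<beta> * y + z" using z(2) by linarith
    have w: "\<beta> * y + z < \<beta> * \<beta>" using pair_less[OF y z(1)] .
    have look: "m' (TRow, y) = \<beta> * y" "m' (TMul, \<beta> * y + (l)) = y * (l)"
      "m' (TLo, \<beta> * y + z) = z" "m' (TLo, v) = v mod \<beta>" "m' (THi, v) = v div \<beta>"
      using tab' x y z(1) v w last(1) by (auto simp: tables_def)
    have gl: "m' (Glob, 0) = l" using tab' by (simp add: tables_def l_def)
    have "v mod \<beta> * \<beta> ^ i + v div \<beta> * (\<beta> * \<beta> ^ i) = v * \<beta> ^ i"
      by (metis add_mult_distrib div_mult_mod_eq add.commute mult.assoc mult.commute)
    moreover have "v + y + 1 = x + c + \<beta>" using z(2) last(2) by (simp add: v_def)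
    then have "v * \<beta> ^ i + y * \<beta> ^ i + \<beta> ^ i = x * \<beta> ^ i + c * \<beta> ^ i + \<beta> * \<beta> ^ i"
      by (metis add_mult_distrib mult_1)
    ultimately have "val \<beta> m' dst i + v mod \<beta> * \<beta> ^ i + v div \<beta> * (\<beta> * \<beta> ^ i) +
        (val \<beta> m cb i + y * \<beta> ^ i) = val \<beta> m ca i + x * \<beta> ^ i + \<beta> * \<beta> ^ i"
      using I unfolding I_def c_def by linarith
    moreover have "dst \<noteq> Tmp" "TMul \<noteq> dst" "TLo \<noteq> dst" "THi \<noteq> dst" "TRow \<noteq> dst" "Glob \<noteq> dst"
      using cols by (auto simp: work_cols_def)
    moreover have "v div \<beta> < 2" using \<open>v < 2 * \<beta>\<close> by (simp add: less_mult_imp_div_less)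
    ultimately show ?thesis
      using I i cols v p w neg xy' look gl sq_le base_pos
      by (auto simp: I_def v_def c_def x_def y_def less_Suc_eq)
  qed
  have init: "I 0 (m((Tmp, 1) := 1))" by (simp add: I_def)
  have fin: "unch {Tmp, dst} m m' \<and>
       (if b \<le> a then m' (Tmp, 1) \<noteq> 0 \<and> holds \<beta> m' dst n (a - b) else m' (Tmp, 1) = 0)"
    if "I n m'" for m'
  proof -
    have eq: "val \<beta> m' dst n + m' (Tmp, 1) * \<beta> ^ n + b = a + \<beta> ^ n" and le: "m' (Tmp, 1) \<le> 1"
      and dig: "\<forall>j<n. m' (dst, j) < \<beta>" and un: "unch {Tmp, dst} m m'"
      using that a b by (auto simp: I_def holds_def)
    \<comment> \<open>With the result below \<open>\<beta> ^ n\<close>, the equation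
      \<open>eq\<close> leaves carry 1 for \<open>b \<le> a\<close> and carry 0 for
      \<open>a < b\<close>.\<close>
    have "val \<beta> m' dst n < \<beta> ^ n" using dig by (simp add: val_less)
    moreover have "m' (Tmp, 1) = 0 \<or> m' (Tmp, 1) = 1" using le by linarith
    ultimately show ?thesis
      using eq dig un by (auto simp: holds_def)
  qed
  have "1 \<le> L" using sq_le base_pos by (metis One_nat_def Suc_leI le_trans nat_0_less_mult_iff)
  then show ?thesis
    unfolding subc_def wp.simps by (intro conjI wp_mono[OF wp_rep[where I = I, OF init body] fin])
qed

lemma wp_copyc:
  assumes "dst \<noteq> src"
  shows "wp N xs L (copyc dst src n)
    (\<lambda>_ m'. unch {dst} m m' \<and> (\<forall>i<n. m' (dst, i) = m (src, i))) t m"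
  unfolding copyc_def
  by (rule wp_rep) (use assms in \<open>auto simp: less_Suc_eq unch_def\<close>)

definition others :: "nat \<Rightarrow> mem \<Rightarrow> mem \<Rightarrow> bool" where
  "others i m m' \<longleftrightarrow> unch {Tmp, ColW, ColX, ColR, ColQ} m m' \<and> (\<forall>j. j \<noteq> i \<longrightarrow> m' (ColQ, j) = m (ColQ, j))"

text \<open>The product is formed before it is compared, so \<open>fits\<close> is required even if
  the subtraction is then refused. The multiplier lies in \<open>Norm\<close>, where
  \<open>mulc\<close> and \<open>subc\<close> do not write, because it is added to the quotient
  digit at the end.\<close>

lemma wp_refine:
  assumes tab: "tables \<beta> m" and e: "m x < \<beta>" and x: "fst x = Norm"
    and r: "holds \<beta> m ColR n r" and b: "holds \<beta> m ColB n b"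
    and fits: "m x * b < \<beta> ^ n" and q: "m (ColQ, i) + m x \<le> L"
  shows "wp N xs L (refine x i n)
    (\<lambda>_ m'. others i m m' \<and>
       (if m x * b \<le> r then holds \<beta> m' ColR n (r - m x * b) \<and> m' (ColQ, i) = m (ColQ, i) + m x
        else holds \<beta> m' ColR n r \<and> m' (ColQ, i) = m (ColQ, i))) t m"
proof -
  let ?p = "m x * b"
  show ?thesis
    unfolding refine_def
  proof (rule wp_seqI[OF wp_mulc[OF tab e b _ _ _ _ _ fits]], goal_cases)
    case (6 t m1)
    then have un1: "unch {Tmp, ColW} m m1" and w: "holds \<beta> m1 ColW n ?p" by auto
    have tab1: "tables \<beta> m1" using tables_unch[OF tab un1] by (simp add: work_cols_def)
    have r1: "holds \<beta> m1 ColR n r" using holds_unch[OF r un1] by simp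
    show ?case
    proof (rule wp_seqI[OF wp_subc[OF tab1 r1 w]], goal_cases)
      case (9 t m2)
      then have un2: "unch {Tmp, ColX} m1 m2" and
        dif: "if ?p \<le> r then m2 (Tmp, 1) \<noteq> 0 \<and> holds \<beta> m2 ColX n (r - ?p) else m2 (Tmp, 1) = 0"
        by auto
      have un: "unch {Tmp, ColW, ColX} m m2" using unch_trans[OF un1 un2] by auto
      have q2: "m2 (ColQ, j) = m (ColQ, j)" for j using unchD[OF un] by simp
      show ?case
      proof (cases "?p \<le> r")
        case True
        with dif have d: "m2 (Tmp, 1) \<noteq> 0" "holds \<beta> m2 ColX n (r - ?p)" by auto
        have "wp N xs L (copyc ColR ColX n ;; Plus (ColQ, i) (ColQ, i) x)
          (\<lambda>_ m'. others i m m' \<and> holds \<beta> m' ColR n (r - ?p) \<and> m' (ColQ, i) = m (ColQ, i) + m x)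
          (t + 4) m2"
        proof (rule wp_seqI[OF wp_copyc], goal_cases)
          case (2 t m3)
          then have un3: "unch {ColR} m2 m3" and c: "\<forall>i<n. m3 (ColR, i) = m2 (ColX, i)" by auto
          have "unch {Tmp, ColW, ColX, ColR} m m3" using unch_trans[OF un un3] by auto
          then have un': "unch {Tmp, ColW, ColX, ColR} m m3"
            "unch {Tmp, ColW, ColX, ColR, ColQ} m m3" by (auto elim: unch_mono)
          have "holds \<beta> m3 ColR n (r - ?p)"
            using holds_cong[of n m3 ColR m2 ColX] d(2) c by simp
          then have "holds \<beta> (m3((ColQ, i) := v)) ColR n (r - ?p)" for v
            by (subst holds_cong[of n _ ColR m3 ColR]) simp_all
          moreover have "m3 x = m x" "m3 (ColQ, j) = m (ColQ, j)" for j
            using unchD[OF un'(1)] x by simp_all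
          ultimately show ?case using un'(2) q by (simp add: others_def)
        qed simp
        then show ?thesis using True d(1) by simp
      next
        case False
        have "others i m m2" using un q2 by (auto simp: others_def elim: unch_mono)
        moreover have "holds \<beta> m2 ColR n r" using holds_unch[OF r un] by simp
        ultimately show ?thesis using False dif q2 by simp
      qed
    qed (simp_all add: work_cols_def)
  qed (simp_all add: work_cols_def)
qed

end

section \<open>Long division\<close>

text \<open>Since \<open>s * (b1 + 1) \<le> \<beta>\<close>, scaling does not lengthen the divisor.
  Maximality of \<open>s\<close> gives \<open>\<beta> < (s + 1) * (b1 + 1)\<close>, hence
  \<open>\<beta> \<le> s * b1 + s + b1\<close>; each summand is at most \<open>s * b1\<close>, which
  is the origin of the factor 3.\<close>

lemma normaliser:
  fixes \<beta> b1 b k :: nat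
  assumes b1: "0 < b1" "b1 < \<beta>" and b: "b1 * \<beta> ^ k \<le> b" "b < Suc b1 * \<beta> ^ k"
  defines "s \<equiv> \<beta> div Suc b1"
  shows "0 < s" "s * b < \<beta> ^ Suc k" "\<beta> \<le> 3 * (s * b div \<beta> ^ k)"
proof -
  have pos: "0 < \<beta> ^ k" using b1 by simp
  show s: "0 < s" using b1 by (simp add: s_def div_greater_zero_iff)
  have "s * b < s * (Suc b1 * \<beta> ^ k)" using s b(2) by simp
  also have "\<dots> = s * Suc b1 * \<beta> ^ k" by (simp only: mult.assoc)
  also have "\<dots> \<le> \<beta> * \<beta> ^ k"
    unfolding s_def by (intro mult_right_mono div_times_less_eq_dividend) simp
  finally show "s * b < \<beta> ^ Suc k" by simp
  have "\<beta> < Suc s * Suc b1"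
    unfolding s_def using dividend_less_div_times[of "Suc b1" \<beta>] by (simp add: algebra_simps)
  moreover have "Suc s * Suc b1 = s * b1 + s + b1 + 1" by simp
  moreover have "s \<le> s * b1" "b1 \<le> s * b1" using s b1 by simp_all
  ultimately have "\<beta> \<le> 3 * (s * b1)" by linarith
  also have "s * b1 \<le> s * b div \<beta> ^ k"
    using pos b(1) by (simp add: less_eq_div_iff_mult_less_eq mult.assoc)
  finally show "\<beta> \<le> 3 * (s * b div \<beta> ^ k)" by simp
qed

text \<open>Scaling both numbers by \<open>s\<close> preserves the quotient. \<open>R\<close> bounds
  the scaled remainder from below and \<open>D + 1\<close> the scaled divisor from above, so
  \<open>e\<close> cannot exceed the true digit; the reverse roundings \<open>R + 1\<close> and
  \<open>D\<close> bound the error.\<close>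

lemma trial_quotient:
  fixes \<beta> b r s k :: nat
  assumes \<beta>: "0 < \<beta>" and b: "0 < b" and r: "r < \<beta> * b" and s: "0 < s"
  defines "R \<equiv> s * r div \<beta> ^ Suc k" and "D \<equiv> s * b div \<beta> ^ k"
  assumes D: "\<beta> \<le> 3 * D"
  defines "e \<equiv> \<beta> * R div Suc D"
  shows "R \<le> D" "e * b \<le> r" "r div b \<le> e + 7"
proof -
  have pos: "0 < \<beta> ^ k" using \<beta> by simp
  have "s * r < \<beta> * (s * b)"
    using r s by (metis mult.left_commute mult_less_cancel1)
  then have "s * r div \<beta> < s * b"
    by (simp add: \<beta> div_less_iff_less_mult mult.commute)
  then show RD: "R \<le> D"
    unfolding R_def D_def using div_le_mono[of "s * r div \<beta>" "s * b" "\<beta> ^ k"]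
    by (simp add: div_mult2_eq)
  have R1: "R * (\<beta> * \<beta> ^ k) \<le> s * r" "s * r < Suc R * (\<beta> * \<beta> ^ k)"
    unfolding R_def using \<beta> dividend_less_div_times[of "\<beta> ^ Suc k" "s * r"]
      div_times_less_eq_dividend[of "s * r" "\<beta> ^ Suc k"]
    by simp_all
  have D1: "D * \<beta> ^ k \<le> s * b" "s * b < Suc D * \<beta> ^ k"
    unfolding D_def using \<beta> dividend_less_div_times[of "\<beta> ^ k" "s * b"]
    by (auto simp: algebra_simps)
  have e: "e * Suc D \<le> \<beta> * R" "\<beta> * R < Suc e * Suc D"
    unfolding e_def using dividend_less_div_times[of "Suc D" "\<beta> * R"]
      div_times_less_eq_dividend[of "\<beta> * R" "Suc D"]
    by simp_all
  have "s * (e * b) = e * (s * b)" by simp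
  also have "\<dots> \<le> e * (Suc D * \<beta> ^ k)" using D1(2) by (intro mult_left_mono) simp_all
  also have "\<dots> = e * Suc D * \<beta> ^ k" by (simp only: mult.assoc)
  also have "\<dots> \<le> \<beta> * R * \<beta> ^ k" by (intro mult_right_mono e) simp
  also have "\<dots> \<le> s * r" using R1(1) by (simp add: mult_ac)
  finally show "e * b \<le> r" using s by simp
  let ?q = "r div b"
  have "?q * D * \<beta> ^ k \<le> ?q * (s * b)" using D1(1) by (simp add: mult.assoc)
  also have "\<dots> = s * (?q * b)" by simp
  also have "\<dots> \<le> s * r" by (intro mult_left_mono div_times_less_eq_dividend) simp
  also have "\<dots> < Suc R * \<beta> * \<beta> ^ k" using R1(2) by (simp add: algebra_simps)
  finally have qD: "?q * D < Suc R * \<beta>" using pos by simp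
  have "\<beta> * R < \<beta> * Suc D" using RD \<beta> by (intro mult_strict_left_mono) simp_all
  with e(1) have "e * Suc D < \<beta> * Suc D" by (rule le_less_trans)
  then have "e < \<beta>" by (simp only: mult_less_cancel2)
  have "?q * D < \<beta> * R + \<beta>" using qD by (simp add: algebra_simps)
  also have "\<dots> \<le> e * D + e + D + \<beta>" using e(2) by simp
  \<comment> \<open>Both \<open>e\<close> and \<beta> are at most \<open>3 * D\<close>, so
    \<open>e + D + \<beta>\<close> contributes 3 + 1 + 3 multiples of \<open>D\<close>.\<close>
  finally have "?q * D < e * D + 7 * D" using D \<open>e < \<beta>\<close> by linarith
  then have "?q * D < (e + 7) * D" by (simp add: algebra_simps)
  then show "?q \<le> e + 7" by simp
qed

text \<open>\<open>r\<close> is the previous remainder with the next digit of \<open>a\<close>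
  brought down. The prefix of \<open>a\<close> differs from \<open>r\<close> by a multiple of
  \<open>\<beta> * b\<close>, which changes neither the remainder nor the last quotient digit, and
  \<open>r < \<beta> * b\<close> makes \<open>r div b\<close> a single digit.\<close>

lemma long_division_step:
  fixes \<beta> a b j :: nat
  assumes "0 < b" "0 < \<beta>"
  defines "r \<equiv> (a div \<beta> ^ Suc j mod b) * \<beta> + a div \<beta> ^ j mod \<beta>"
  shows "r mod b = a div \<beta> ^ j mod b" "r div b = a div b div \<beta> ^ j mod \<beta>" "r < \<beta> * b"
proof -
  let ?x = "a div \<beta> ^ j" and ?y = "a div \<beta> ^ Suc j"
  have y: "?y = ?x div \<beta>" by (simp only: power_Suc2 div_mult2_eq)
  have "?x = ?y * \<beta> + ?x mod \<beta>" unfolding y by simp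
  also have "\<dots> = (?y div b * b + ?y mod b) * \<beta> + ?x mod \<beta>" by simp
  also have "\<dots> = r + b * (\<beta> * (?y div b))"
    unfolding r_def by (simp only: algebra_simps)
  finally have x: "?x = r + b * (\<beta> * (?y div b))" .
  show "r mod b = ?x mod b" by (simp add: x)
  have "(?y mod b) * \<beta> + ?x mod \<beta> < Suc (?y mod b) * \<beta>" using assms by simp
  also have "\<dots> \<le> b * \<beta>" using assms by (intro mult_right_mono) (simp_all add: Suc_leI)
  finally show r: "r < \<beta> * b" by (simp add: r_def mult.commute)
  have "?x div b = \<beta> * (?y div b) + r div b" using assms(1) by (simp add: x)
  moreover have "r div b < \<beta>" using r by (simp add: less_mult_imp_div_less)
  ultimately have "?x div b mod \<beta> = r div b" by simp
  then show "r div b = a div b div \<beta> ^ j mod \<beta>"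
    by (simp add: div_mult2_eq[symmetric] mult.commute)
qed

text \<open>
  Slots of \<open>Norm\<close>: 0 and 2 hold the position \<open>k\<close> of the leading digit of the divisor and \<open>k + 1\<close>,
  1 holds the constant 1, 3 the leading digit itself, 4 the scaling factor \<open>s\<close>, 5 the table row
  \<open>\<beta> * (s * b div \<beta> ^ k)\<close>, and 6 the trial digit.
\<close>

definition locate :: "nat \<Rightarrow> com" where
  "locate n = rep n (\<lambda>i. IfZero (ColB, i) Skip
     (Const (Norm, 0) i ;; Const (Norm, 2) (Suc i) ;; Move (Norm, 3) (ColB, i)))"

text \<open>The factor \<open>\<beta> div Suc b1\<close> is entry 1 of row \<open>b1\<close> of
  \<open>TQuo\<close>, so it needs no table of its own. Of the scaled divisor only the leading digit
  survives, as a table row; \<open>ColB\<close> keeps the original divisor.\<close>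

definition scale :: "nat \<Rightarrow> com" where
  "scale n = Get (Tmp, 0) TRow (Norm, 3) ;; Plus (Tmp, 0) (Tmp, 0) (Norm, 1) ;;
     Get (Norm, 4) TQuo (Tmp, 0) ;; mulc ColX (Norm, 4) ColB n ;;
     Get (Tmp, 0) ColX (Norm, 0) ;; Get (Norm, 5) TRow (Tmp, 0)"

text \<open>Divisor and remainder get an extra leading digit 0: a remainder with a digit brought
  down, or a digit times the divisor, may need \<open>n + 1\<close> digits.\<close>

definition load :: "nat \<Rightarrow> com" where
  "load n = rep n (\<lambda>i. Read (ColA, i) i ;; Read (ColB, i) (n + i)) ;;
     rep (Suc n) (\<lambda>i. Const (ColR, i) 0) ;; Const (ColB, n) 0 ;; Const (Norm, 1) 1"

definition trial :: "nat \<Rightarrow> com" where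
  "trial n = mulc ColX (Norm, 4) ColR n ;; Get (Tmp, 0) ColX (Norm, 2) ;;
     Plus (Tmp, 0) (Tmp, 0) (Norm, 5) ;; Get (Norm, 6) TQuo (Tmp, 0)"

text \<open>The detour through \<open>ColX\<close> prevents digits of \<open>ColR\<close> from being
  overwritten before they are read.\<close>

definition shift :: "nat \<Rightarrow> nat \<Rightarrow> com" where
  "shift j n = rep n (\<lambda>i. Move (ColX, Suc i) (ColR, i)) ;; Move (ColX, 0) (ColA, j) ;;
     copyc ColR ColX (Suc n)"

definition next_digit :: "nat \<Rightarrow> nat \<Rightarrow> com" where
  "next_digit j n = shift j n ;; Const (ColQ, j) 0 ;; trial (Suc n) ;; refine (Norm, 6) j (Suc n) ;;
     rep 7 (\<lambda>_. refine (Norm, 1) j (Suc n))"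

definition divide :: "nat \<Rightarrow> com" where
  "divide n = load n ;; locate n ;; scale (Suc n) ;; rep n (\<lambda>i. next_digit (n - Suc i) n)"

context radix
begin

text \<open>What stays fixed during the digit loop.\<close>

definition ready :: "nat \<Rightarrow> nat \<Rightarrow> nat \<Rightarrow> nat \<Rightarrow> nat \<Rightarrow> mem \<Rightarrow> bool" where
  "ready n a b k s m \<longleftrightarrow> tables \<beta> m \<and> holds \<beta> m ColB (Suc n) b \<and>
     (\<forall>i<n. m (ColA, i) = a div \<beta> ^ i mod \<beta>) \<and>
     m (Norm, 1) = 1 \<and> m (Norm, 2) = Suc k \<and> m (Norm, 4) = s \<and>
     m (Norm, 5) = \<beta> * (s * b div \<beta> ^ k) \<and>
     0 < b \<and> k < n \<and> 0 < s \<and> s < \<beta> \<and> s * b < \<beta> ^ Suc k \<and> \<beta> \<le> 3 * (s * b div \<beta> ^ k)"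

definition inner :: "nat \<Rightarrow> mem \<Rightarrow> mem \<Rightarrow> bool" where
  "inner j m m' \<longleftrightarrow> unch {Tmp, Norm, ColW, ColX, ColR, ColQ} m m' \<and>
     (\<forall>i. i \<noteq> 6 \<longrightarrow> m' (Norm, i) = m (Norm, i)) \<and> (\<forall>i. i \<noteq> j \<longrightarrow> m' (ColQ, i) = m (ColQ, i))"

lemma inner_trans: "inner j m m' \<Longrightarrow> inner j m' m'' \<Longrightarrow> inner j m m''"
  unfolding inner_def using unch_trans[of _ m m' _ m''] by fastforce

lemma inner_others: "others j m m' \<Longrightarrow> inner j m m'"
  unfolding inner_def others_def
  using unchD[of "{Tmp, ColW, ColX, ColR, ColQ}" m m'] by (auto elim: unch_mono)

lemma inner_unch: "unch {Tmp, ColX, ColR} m m' \<Longrightarrow> inner j m m'"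
  unfolding inner_def using unchD[of "{Tmp, ColX, ColR}" m m'] by (auto elim: unch_mono)

lemma ready_inner:
  assumes "ready n a b k s m" "inner j m m'"
  shows "ready n a b k s m'"
proof -
  have un: "unch {Tmp, Norm, ColW, ColX, ColR, ColQ} m m'" using assms by (simp add: inner_def)
  have "tables \<beta> m'"
    using assms(1) un by (auto simp: ready_def work_cols_def elim: tables_unch)
  moreover have "holds \<beta> m' ColB (Suc n) b"
    using assms(1) holds_unch[OF _ un] by (simp add: ready_def)
  ultimately show ?thesis
    using assms unchD[OF un] by (auto simp: ready_def inner_def)
qed

lemma wp_shift_digit:
  assumes m: "ready n a b k s m" and r: "holds \<beta> m ColR (Suc n) r" "r < \<beta> ^ n" and j: "j < n"
  shows "wp N xs L (shift j n)
    (\<lambda>_ m'. unch {Tmp, ColX, ColR} m m' \<and>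
       holds \<beta> m' ColR (Suc n) (r * \<beta> + a div \<beta> ^ j mod \<beta>)) t m"
  unfolding shift_def
proof (rule wp_seqI, rule wp_rep[where I = "\<lambda>i m'. unch {ColX} m m' \<and> (\<forall>l<i. m' (ColX, Suc l) = m (ColR, l))"],
    goal_cases)
  case (2 i t m')
  then show ?case using unchD[of "{ColX}" m m'] by (auto simp: less_Suc_eq)
next
  case (3 t m1)
  then have un1: "unch {ColX} m m1" and x1: "\<forall>l<n. m1 (ColX, Suc l) = m (ColR, l)" by auto
  let ?d = "a div \<beta> ^ j mod \<beta>"
  let ?m = "m1((ColX, 0) := ?d)"
  have d: "m1 (ColA, j) = ?d" using unchD[OF un1] m j by (simp add: ready_def)
  \<comment> \<open>By \<open>r < \<beta> ^ n\<close> the top digit is 0, so the shift loses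
    nothing.\<close>
  have top: "val \<beta> m ColR n = r" "\<forall>l<n. m (ColR, l) < \<beta>"
    using r holds_digit[OF r(1), of n] base_pos by (auto simp: holds_def)
  have "val \<beta> ?m ColX (Suc l) = val \<beta> m ColR l * \<beta> + ?d" if "l \<le> n" for l
    using that x1 by (induction l) (auto simp: algebra_simps)
  then have x: "holds \<beta> ?m ColX (Suc n) (r * \<beta> + ?d)"
    using top x1 base_pos by (auto simp: holds_def less_Suc_eq_0_disj)
  have "wp N xs L (copyc ColR ColX (Suc n))
    (\<lambda>_ m'. unch {Tmp, ColX, ColR} m m' \<and> holds \<beta> m' ColR (Suc n) (r * \<beta> + ?d)) (t + 22) ?m"
  proof (rule wp_mono[OF wp_copyc], goal_cases)
    case (2 t m')
    then show ?case
      using x holds_cong[of "Suc n" m' ColR ?m ColX] un1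
      by (auto simp: unch_def)
  qed simp
  then show ?case by (simp add: d)
qed simp

lemma wp_trial:
  assumes m: "ready n a b k s m" and r: "holds \<beta> m ColR (Suc n) r" "r < \<beta> * b"
  shows "wp N xs L (trial (Suc n))
    (\<lambda>_ m'. inner j m m' \<and> m' (ColQ, j) = m (ColQ, j) \<and> holds \<beta> m' ColR (Suc n) r \<and>
       m' (Norm, 6) < \<beta> \<and> m' (Norm, 6) * b \<le> r \<and> r div b \<le> m' (Norm, 6) + 7) t m"
  unfolding trial_def
proof (rule wp_seqI, rule wp_mulc[where u = r], goal_cases)
  case 1
  then show ?case using m by (simp add: ready_def)
next
  case 2
  then show ?case using m by (simp add: ready_def)
next
  case 3
  then show ?case by (rule r)
next
  case 9
  \<comment> \<open>The scaled remainder needs at most one digit more than \<open>s * b\<close>,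
    which has at most \<open>k + 1 \<le> n\<close>.\<close>
  have "s * r < s * (\<beta> * b)" using r m by (simp add: ready_def)
  also have "\<dots> < \<beta> * \<beta> ^ Suc k" using m base_pos by (simp add: ready_def mult.left_commute)
  also have "\<dots> \<le> \<beta> ^ Suc n" using m base_pos
    by (auto simp: ready_def simp flip: power_Suc intro!: power_increasing)
  finally show ?case using m by (simp add: ready_def)
next
  case (10 t m1)
  then have un: "unch {Tmp, ColX} m m1" and x: "holds \<beta> m1 ColX (Suc n) (s * r)"
    using m by (auto simp: ready_def)
  let ?D = "s * b div \<beta> ^ k" and ?R = "s * r div \<beta> ^ Suc k"
  let ?e = "\<beta> * ?R div Suc ?D"
  have rd: "ready n a b k s m1" using ready_inner[OF m inner_unch] un unch_mono by blast
  have *: "0 < b" "0 < s" "\<beta> \<le> 3 * ?D" "k < n" using m by (simp_all add: ready_def)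
  have tq: "?R \<le> ?D" "?e * b \<le> r" "r div b \<le> ?e + 7"
    using trial_quotient[OF base_pos *(1) r(2) *(2,3)] by simp_all
  have D: "?D < \<beta>" using m by (simp add: ready_def less_mult_imp_div_less)
  \<comment> \<open>\<open>?R \<le> ?D < \<beta>\<close> makes \<open>?R\<close> exactly digit
    \<open>k + 1\<close> of \<open>s * r\<close>, and keeps the look-up inside the specified part of
    row \<open>?D\<close>.\<close>
  have "?R < \<beta>" using tq(1) D by simp
  then have "m1 (ColX, Suc k) = ?R"
    using holds_digit[OF x, of "Suc k"] *(4) by simp
  moreover have "\<beta> * ?D + ?R < \<beta> * \<beta>" using pair_less D \<open>?R < \<beta>\<close> .
  moreover have "m1 (TQuo, \<beta> * ?D + ?R) = ?e"
    using rd D tq(1) by (simp add: ready_def tables_def)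
  moreover have "?e < \<beta>"
  proof -
    have "\<beta> * ?R < \<beta> * Suc ?D" using tq(1) base_pos by (intro mult_strict_left_mono) simp_all
    then show ?thesis by (simp add: less_mult_imp_div_less)
  qed
  moreover have "inner j m (m1((Tmp, 0) := v, (Norm, 6) := w))" for v w
    using unchD[OF un] un by (auto simp: inner_def elim: unch_mono)
  moreover have "holds \<beta> (m1((Tmp, 0) := v, (Norm, 6) := w)) ColR (Suc n) r" for v w
    using holds_unch[OF r(1) un] by (subst holds_cong[of _ _ ColR m1 ColR]) auto
  moreover have "m1 (ColQ, j) = m (ColQ, j)" using unchD[OF un] by simp
  ultimately show ?case
    using rd tq(2,3) sq_le by (simp add: ready_def add.commute)
qed (simp_all add: work_cols_def)

lemma wp_next_digit:
  assumes m: "ready n a b k s m" and R: "holds \<beta> m ColR (Suc n) (a div \<beta> ^ Suc j mod b)"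
    and j: "j < n"
  shows "wp N xs L (next_digit j n)
    (\<lambda>_ m'. inner j m m' \<and> holds \<beta> m' ColR (Suc n) (a div \<beta> ^ j mod b) \<and>
       m' (ColQ, j) = a div b div \<beta> ^ j mod \<beta>) t m"
proof -
  let ?d = "a div \<beta> ^ j mod \<beta>"
  let ?r = "(a div \<beta> ^ Suc j mod b) * \<beta> + ?d"
  let ?q = "?r div b"
  have b: "0 < b" using m by (simp add: ready_def)
  \<comment> \<open>\<open>ready\<close> bounds \<open>s * b\<close>; as \<open>s\<close> is
    positive, this also bounds \<open>b\<close>.\<close>
  have "1 * b \<le> s * b" using m by (intro mult_right_mono) (auto simp: ready_def)
  also have "\<dots> < \<beta> ^ Suc k" using m by (simp add: ready_def)
  also have "\<dots> \<le> \<beta> ^ n" 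
    by (rule power_increasing) (use m base_pos in \<open>auto simp: ready_def\<close>)
  finally have bn: "b < \<beta> ^ n" by simp
  have fits: "e * b < \<beta> ^ Suc n" if "e < \<beta>" for e
  proof -
    have "e * b \<le> \<beta> * b" using that by simp
    also have "\<dots> < \<beta> ^ Suc n" using bn base_pos by simp
    finally show ?thesis .
  qed
  have r0: "a div \<beta> ^ Suc j mod b < \<beta> ^ n" using b bn by (meson less_trans mod_less_divisor)
  note step = long_division_step[OF b base_pos, of a j]
  have q: "?q < \<beta>" using step(3) by (simp add: less_mult_imp_div_less)
  have "\<beta> \<le> L" using sq_le base_pos by (metis dual_order.trans le_square)
  have "2 \<le> L" using base_ge \<open>\<beta> \<le> L\<close> by simp
  show ?thesis
    unfolding next_digit_def
  proof (rule wp_seqI[OF wp_shift_digit[OF m R r0 j]], goal_cases)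
    case (1 t m1)
    then have in1: "inner j m m1" and R1: "holds \<beta> m1 ColR (Suc n) ?r"
      using inner_unch by auto
    define m2 where "m2 = m1((ColQ, j) := 0)"
    have in2: "inner j m m2" and Q2: "m2 (ColQ, j) = 0"
      using in1 by (auto simp: m2_def inner_def)
    have R2: "holds \<beta> m2 ColR (Suc n) ?r"
      unfolding m2_def by (subst holds_cong[of _ _ ColR m1 ColR]) (use R1 in simp_all)
    have "wp N xs L (trial (Suc n) ;; refine (Norm, 6) j (Suc n) ;;
        rep 7 (\<lambda>_. refine (Norm, 1) j (Suc n)))
      (\<lambda>_ m'. inner j m m' \<and> holds \<beta> m' ColR (Suc n) (a div \<beta> ^ j mod b) \<and>
        m' (ColQ, j) = a div b div \<beta> ^ j mod \<beta>) (t + 22) m2"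
    proof (rule wp_seqI[OF wp_trial[OF ready_inner[OF m in2] R2 step(3), of j]], goal_cases)
      case (1 t m3)
      let ?e = "m3 (Norm, 6)"
      have in3: "inner j m m3" using 1 in2 inner_trans by blast
      have e: "?e < \<beta>" "?e * b \<le> ?r" "?q \<le> ?e + 7" "m3 (ColQ, j) = 0"
        and R3: "holds \<beta> m3 ColR (Suc n) ?r" using 1 Q2 by auto
      have rd3: "ready n a b k s m3" using ready_inner[OF m in3] .
      then have t3: "tables \<beta> m3" "holds \<beta> m3 ColB (Suc n) b" by (simp_all add: ready_def)
      have "m3 (ColQ, j) + ?e \<le> L" using e \<open>\<beta> \<le> L\<close> by simp
      from wp_refine[OF t3(1) e(1) _ R3 t3(2) fits[OF e(1)] this] show ?case
      proof (rule wp_seqI, goal_cases)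
        case (2 t m4)
        \<comment> \<open>Every correction raises the digit by one until it reaches
          \<open>?q\<close>; from then on the subtraction is refused. Hence the minimum, which after
          7 rounds is \<open>?q\<close>.\<close>
        define I where "I i m' \<longleftrightarrow> inner j m m' \<and>
          holds \<beta> m' ColR (Suc n) (?r - min ?q (?e + i) * b) \<and> m' (ColQ, j) = min ?q (?e + i)"
          for i m'
        have "?e \<le> ?q" using e(2) b by (simp add: less_eq_div_iff_mult_less_eq)
        then have init: "I 0 m4"
          using 2 e inner_trans[OF in3] inner_others by (auto simp: I_def)
        have body: "wp N xs L (refine (Norm, 1) j (Suc n)) (\<lambda>_. I (Suc i)) t m'"
          if "I i m'" for i t m'
        proof -
          let ?c = "min ?q (?e + i)"
          have in': "inner j m m'" and R': "holds \<beta> m' ColR (Suc n) (?r - ?c * b)"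
            and Q': "m' (ColQ, j) = ?c" using that by (auto simp: I_def)
          have "ready n a b k s m'" using ready_inner[OF m in'] .
          then have *: "tables \<beta> m'" "holds \<beta> m' ColB (Suc n) b" "m' (Norm, 1) = 1"
            by (simp_all add: ready_def)
          show ?thesis
          proof (rule wp_mono[OF wp_refine[OF *(1) _ _ R' *(2)]], goal_cases)
            case (5 t m'')
            then have o: "inner j m m''" using inner_trans[OF in'] inner_others by blast
            show ?case
            proof (cases "?e + i < ?q")
              case True
              then have "Suc (?e + i) * b \<le> ?r"
                using b by (simp only: less_eq_div_iff_mult_less_eq[symmetric] Suc_le_eq)
              then have "b \<le> ?r - (?e + i) * b" by simp
              with True 5 o show ?thesis
                using Q' * by (simp add: I_def diff_diff_left add.commute)
            next
              case False
              then have c: "?c = ?q" "min ?q (?e + Suc i) = ?q" by auto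
              have "?r - ?q * b < b" using b by (simp add: minus_div_mult_eq_mod)
              then show ?thesis
                using 5 o Q' * unfolding I_def c by (simp split: if_splits)
            qed
          qed (use * fits[of 1] base_ge Q' q \<open>\<beta> \<le> L\<close> in auto)
        qed
        show ?case
        proof (rule wp_mono[OF wp_rep[where I = I, OF init body]], assumption)
          fix t m' assume I7: "I 7 m'"
          have c: "min ?q (?e + 7) = ?q" using e(3) by simp
          have r: "?r - ?q * b = a div \<beta> ^ j mod b"
            using step(1) by (simp only: minus_div_mult_eq_mod)
          from I7[unfolded I_def c r, unfolded step(2)]
          show "inner j m m' \<and> holds \<beta> m' ColR (Suc n) (a div \<beta> ^ j mod b) \<and>
            m' (ColQ, j) = a div b div \<beta> ^ j mod \<beta>"
            by blast
        qed
      qed simp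
    qed
    then show ?case by (simp add: m2_def)
  qed
qed

end

section \<open>Loading, normalisation and the complete division\<close>

lemma val_truncate:
  assumes "k \<le> n" "\<And>i. k \<le> i \<Longrightarrow> i < n \<Longrightarrow> m (j, i) = 0"
  shows "val \<beta> m j n = val \<beta> m j k"
  using assms by (induction n rule: dec_induct) auto

context radix
begin

lemma wp_load:
  assumes xs: "xs = digits \<beta> n a @ digits \<beta> n b" and b: "b < \<beta> ^ n"
  shows "wp N xs L (load n) (\<lambda>_ m'. unch work_cols m m' \<and>
    (\<forall>i<n. m' (ColA, i) = a div \<beta> ^ i mod \<beta>) \<and> holds \<beta> m' ColB (Suc n) b \<and>
    holds \<beta> m' ColR (Suc n) 0 \<and> m' (Norm, 1) = 1) t m"
proof -
  define I where "I i m' \<longleftrightarrow> unch work_cols m m' \<and>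
    (\<forall>l<i. m' (ColA, l) = a div \<beta> ^ l mod \<beta> \<and> m' (ColB, l) = b div \<beta> ^ l mod \<beta>)" for i m'
  have small: "x mod \<beta> < \<beta>" "x mod \<beta> \<le> L" "1 \<le> L" for x
  proof -
    show "x mod \<beta> < \<beta>" using base_pos by simp
    moreover have "\<beta> \<le> \<beta> * \<beta>" using base_pos by simp
    ultimately show "x mod \<beta> \<le> L" "1 \<le> L" using sq_le base_pos by linarith+
  qed
  have at: "(digits \<beta> n a @ digits \<beta> n b) ! i = a div \<beta> ^ i mod \<beta>"
    "(digits \<beta> n a @ digits \<beta> n b) ! (n + i) = b div \<beta> ^ i mod \<beta>" if "i < n" for i
    using that by (simp_all add: digits_def nth_append)
  have len: "length (digits \<beta> n x) = n" for x by (simp add: digits_def)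
  show ?thesis
    unfolding load_def
  proof (rule wp_seqI, rule wp_rep[where I = I], goal_cases)
    case 1
    then show ?case by (simp add: I_def)
  next
    case (2 i t m')
    then show ?case using at[of i] small(2)
      by (auto simp: I_def xs len work_cols_def less_Suc_eq)
  next
    case (3 t m1)
    show ?case
    proof (rule wp_seqI, rule wp_rep[where I = "\<lambda>i m'. I n m' \<and> (\<forall>l<i. m' (ColR, l) = 0)"], goal_cases)
      case 1
      with 3 show ?case by simp
    next
      case (2 i t m')
      then show ?case by (auto simp: I_def work_cols_def less_Suc_eq)
    next
      case (3 t m2)
      let ?m = "m2((ColB, n) := 0, (Norm, 1) := 1)"
      have "val \<beta> m2 ColB n = (\<Sum>i<n. digits \<beta> n b ! i * \<beta> ^ i)"
        unfolding val_def by (rule sum.cong) (use 3 in \<open>auto simp: I_def digits_def\<close>)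
      then have "val \<beta> m2 ColB n = b" using b by (simp add: digits_value)
      then have "holds \<beta> ?m ColB (Suc n) b"
        using 3 small(1) base_pos by (auto simp: holds_def I_def less_Suc_eq)
      moreover have "holds \<beta> ?m ColR (Suc n) 0"
        using 3 base_pos val_truncate[of 0 "Suc n" ?m ColR \<beta>] by (auto simp: holds_def)
      moreover have "unch work_cols m ?m" using 3 by (simp add: I_def work_cols_def)
      ultimately show ?case using 3 small(3) by (auto simp: I_def)
    qed
  qed
qed

text \<open>The scan ascends and each nonzero digit overwrites the previous find, so the leading one
  remains. As all digits above it vanish, it satisfies the two bounds that \<open>normaliser\<close>
  starts from.\<close>

lemma wp_locate:
  assumes b: "holds \<beta> m ColB (Suc n) b" "b < \<beta> ^ n" "0 < b" and n: "n \<le> L"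
  shows "wp N xs L (locate n) (\<lambda>_ m'. unch {Norm} m m' \<and> m' (Norm, 1) = m (Norm, 1) \<and>
    (\<exists>k<n. m' (Norm, 0) = k \<and> m' (Norm, 2) = Suc k \<and> m' (Norm, 3) = m (ColB, k) \<and>
       0 < m (ColB, k) \<and> m (ColB, k) * \<beta> ^ k \<le> b \<and> b < Suc (m (ColB, k)) * \<beta> ^ k)) t m"
proof -
  define I where "I i m' \<longleftrightarrow> unch {Norm} m m' \<and> m' (Norm, 1) = m (Norm, 1) \<and>
    ((\<exists>l<i. m (ColB, l) \<noteq> 0) \<longrightarrow>
       (\<exists>k<i. m' (Norm, 0) = k \<and> m' (Norm, 2) = Suc k \<and> m' (Norm, 3) = m (ColB, k) \<and>
          0 < m (ColB, k) \<and> (\<forall>l. k < l \<and> l < i \<longrightarrow> m (ColB, l) = 0)))" for i m'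
  have body: "wp N xs L (IfZero (ColB, i) Skip
     (Const (Norm, 0) i ;; Const (Norm, 2) (Suc i) ;; Move (Norm, 3) (ColB, i)))
     (\<lambda>_. I (Suc i)) t m'" if i: "i < n" and I: "I i m'" for i t m'
  proof -
    have un: "unch {Norm} m m'" and one: "m' (Norm, 1) = m (Norm, 1)" using I by (auto simp: I_def)
    have d: "m' (ColB, i) = m (ColB, i)" using unchD[OF un] by simp
    show ?thesis
    proof (cases "m (ColB, i) = 0")
      case True
      then have "I (Suc i) m'" using I unfolding I_def by (metis less_Suc_eq)
      then show ?thesis using d True by simp
    next
      case False
      then have "I (Suc i) (m'((Norm, 0) := i, (Norm, 2) := Suc i, (Norm, 3) := m (ColB, i)))"
        unfolding I_def using un one by (auto intro!: exI[of _ i])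
      then show ?thesis using d False i n by simp
    qed
  qed
  have "val \<beta> m ColB n = b" and top: "m (ColB, n) = 0"
    using b holds_digit[OF b(1), of n] base_pos by (auto simp: holds_def)
  moreover have "val \<beta> m ColB n = 0" if "\<And>i. i < n \<Longrightarrow> m (ColB, i) = 0"
    using that val_truncate[of 0 n m ColB \<beta>] by simp
  ultimately have ex: "\<exists>l<n. m (ColB, l) \<noteq> 0" using b(3) by fastforce
  show ?thesis
    unfolding locate_def
  proof (rule wp_mono[OF wp_rep[where I = I, OF _ body]], goal_cases)
    case (4 t m')
    with ex obtain k where k: "k < n" "m' (Norm, 0) = k" "m' (Norm, 2) = Suc k"
      "m' (Norm, 3) = m (ColB, k)" "0 < m (ColB, k)" "\<forall>l. k < l \<and> l < n \<longrightarrow> m (ColB, l) = 0"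
      unfolding I_def by blast
    have "val \<beta> m ColB n = val \<beta> m ColB (Suc k)"
      using k by (intro val_truncate) auto
    then have bk: "b = val \<beta> m ColB k + m (ColB, k) * \<beta> ^ k"
      using \<open>val \<beta> m ColB n = b\<close> by simp
    moreover have "val \<beta> m ColB k < \<beta> ^ k"
      using b(1) k(1) by (intro val_less) (simp add: holds_def)
    ultimately have "m (ColB, k) * \<beta> ^ k \<le> b" "b < Suc (m (ColB, k)) * \<beta> ^ k" by simp_all
    with 4 k show ?case unfolding I_def by blast
  qed (auto simp: I_def)
qed

lemma wp_scale:
  assumes tab: "tables \<beta> m" and b: "holds \<beta> m ColB (Suc n) b" "0 < b"
    and a: "\<forall>i<n. m (ColA, i) = a div \<beta> ^ i mod \<beta>"
    and k: "k < n" "m (Norm, 0) = k" "m (Norm, 1) = 1" "m (Norm, 2) = Suc k"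
      "m (Norm, 3) = m (ColB, k)" "0 < m (ColB, k)"
      "m (ColB, k) * \<beta> ^ k \<le> b" "b < Suc (m (ColB, k)) * \<beta> ^ k"
  shows "wp N xs L (scale (Suc n))
    (\<lambda>_ m'. unch {Tmp, Norm, ColX} m m' \<and> (\<exists>s. ready n a b k s m')) t m"
proof -
  define b1 where "b1 = m (ColB, k)"
  define s where "s = \<beta> div Suc b1"
  have b1: "0 < b1" "b1 < \<beta>" "m (Norm, 3) = b1" using k b by (auto simp: b1_def holds_def)
  have s: "0 < s" "s * b < \<beta> ^ Suc k" "\<beta> \<le> 3 * (s * b div \<beta> ^ k)"
    using normaliser[OF b1(1,2), of k b] k by (auto simp: b1_def s_def)
  \<comment> \<open>\<open>s\<close> must itself be a digit to serve as multiplier in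
    \<open>mulc\<close>; this uses \<open>0 < b1\<close>.\<close>
  have "s \<le> \<beta> div 2" unfolding s_def using b1 by (intro div_le_mono2) auto
  then have s\<beta>: "s < \<beta>" using base_ge by linarith
  have look: "m (TRow, b1) = \<beta> * b1" "m (TQuo, Suc (\<beta> * b1)) = s"
  proof -
    show "m (TRow, b1) = \<beta> * b1" using tab b1 by (simp add: tables_def)
    have "m (TQuo, \<beta> * b1 + 1) = \<beta> * 1 div Suc b1"
      using tab b1 unfolding tables_def by (metis One_nat_def Suc_leI)
    then show "m (TQuo, Suc (\<beta> * b1)) = s" by (simp add: s_def)
  qed
  let ?m = "m((Tmp, 0) := Suc (\<beta> * b1), (Norm, 4) := s)"
  have un0: "unch {Tmp, Norm} m ?m" by simp
  have t0: "tables \<beta> ?m" using tables_unch[OF tab un0] by (simp add: work_cols_def)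
  have h0: "holds \<beta> ?m ColB (Suc n) b" using holds_unch[OF b(1) un0] by simp
  have "s * b < \<beta> ^ Suc n"
    by (rule less_le_trans[OF s(2) power_increasing]) (use k(1) base_pos in auto)
  then have fits: "?m (Norm, 4) * b < \<beta> ^ Suc n" by simp
  have "wp N xs L (mulc ColX (Norm, 4) ColB (Suc n) ;;
       Get (Tmp, 0) ColX (Norm, 0) ;; Get (Norm, 5) TRow (Tmp, 0))
    (\<lambda>_ m'. unch {Tmp, Norm, ColX} m m' \<and> (\<exists>s. ready n a b k s m')) (t + 22 + 22 + 22) ?m"
  proof (rule wp_seqI[OF wp_mulc[OF t0 _ h0 _ _ _ _ _ fits]], goal_cases)
    case (7 t m1)
    then have un1: "unch {Tmp, ColX} ?m m1" and "holds \<beta> m1 ColX (Suc n) (?m (Norm, 4) * b)"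
      by blast+
    then have x: "holds \<beta> m1 ColX (Suc n) (s * b)" by simp
    let ?D = "s * b div \<beta> ^ k"
    have D: "?D < \<beta>" using s(2) by (simp add: less_mult_imp_div_less)
    then have xD: "m1 (ColX, k) = ?D" using holds_digit[OF x, of k] k(1) by simp
    let ?m' = "m1((Tmp, 0) := ?D, (Norm, 5) := \<beta> * ?D)"
    have un: "unch {Tmp, Norm, ColX} m m1" using unch_trans[OF un0 un1] by auto
    then have un': "unch {Tmp, Norm, ColX} m ?m'" by simp
    have row: "m1 (TRow, ?D) = \<beta> * ?D"
      using tables_unch[OF tab un] D by (simp add: tables_def work_cols_def)
    have norm: "m1 (Norm, i) = ?m (Norm, i)" for i using unchD[OF un1] by simp
    have "ready n a b k s ?m'"
      unfolding ready_def
      using tables_unch[OF tab un'] holds_unch[OF b(1) un'] a b(2) k s s\<beta> norm unchD[OF un]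
      by (simp add: work_cols_def)
    then show ?case using un' xD row norm k by auto
  qed (use s\<beta> in \<open>simp_all add: work_cols_def\<close>)
  then show ?thesis
    using look b1 k(3) pair_less[of b1 1] base_ge sq_le by (simp add: scale_def)
qed

lemma wp_divide:
  assumes tab: "tables \<beta> m" and xs: "xs = digits \<beta> n a @ digits \<beta> n b"
    and ab: "a < \<beta> ^ n" "b < \<beta> ^ n" "0 < b" and n: "n \<le> L"
  shows "wp N xs L (divide n) (\<lambda>_ m'. tables \<beta> m' \<and>
    (\<forall>i<n. m' (ColQ, i) = a div b div \<beta> ^ i mod \<beta> \<and> m' (ColR, i) = a mod b div \<beta> ^ i mod \<beta>)) t m"
  unfolding divide_def
proof (rule wp_seqI[OF wp_load[OF xs ab(2)]], goal_cases)
  case (1 t m1)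
  then have un1: "unch work_cols m m1" and A1: "\<forall>i<n. m1 (ColA, i) = a div \<beta> ^ i mod \<beta>"
    and B1: "holds \<beta> m1 ColB (Suc n) b" and R1: "holds \<beta> m1 ColR (Suc n) 0"
    and one: "m1 (Norm, 1) = 1" by auto
  have t1: "tables \<beta> m1" using tables_unch[OF tab un1] by simp
  show ?case
  proof (rule wp_seqI[OF wp_locate[OF B1 ab(2,3) n]], goal_cases)
    case (1 t m2)
    then obtain k where un2: "unch {Norm} m1 m2" and k: "k < n" "m2 (Norm, 0) = k"
      "m2 (Norm, 1) = 1" "m2 (Norm, 2) = Suc k" "m2 (Norm, 3) = m1 (ColB, k)" "0 < m1 (ColB, k)"
      "m1 (ColB, k) * \<beta> ^ k \<le> b" "b < Suc (m1 (ColB, k)) * \<beta> ^ k"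
      using one by auto
    have eq: "m2 (ColB, i) = m1 (ColB, i)" "m2 (ColA, i) = m1 (ColA, i)" for i
      using unchD[OF un2] by simp_all
    have t2: "tables \<beta> m2" using tables_unch[OF t1 un2] by (simp add: work_cols_def)
    have B2: "holds \<beta> m2 ColB (Suc n) b" and R2: "holds \<beta> m2 ColR (Suc n) 0"
      using holds_unch[OF _ un2] B1 R1 by simp_all
    have A2: "\<forall>i<n. m2 (ColA, i) = a div \<beta> ^ i mod \<beta>" using A1 eq by simp
    show ?case
    proof (rule wp_seqI[OF wp_scale[OF t2 B2 ab(3) A2 k(1-4)]], goal_cases)
      case (5 t m3)
      then obtain s where un3: "unch {Tmp, Norm, ColX} m2 m3" and rd: "ready n a b k s m3" by auto
      \<comment> \<open>Digits are produced from the top: after \<open>i\<close> rounds the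
        remainder belongs to the prefix \<open>a div \<beta> ^ (n - i)\<close>, which is 0 at the
        start because \<open>a < \<beta> ^ n\<close>.\<close>
      define I where "I i m' \<longleftrightarrow> ready n a b k s m' \<and>
        holds \<beta> m' ColR (Suc n) (a div \<beta> ^ (n - i) mod b) \<and>
        (\<forall>j<n. n - i \<le> j \<longrightarrow> m' (ColQ, j) = a div b div \<beta> ^ j mod \<beta>)" for i m'
      have init: "I 0 m3"
        using rd holds_unch[OF R2 un3] ab(1) by (simp add: I_def)
      have body: "wp N xs L (next_digit (n - Suc i) n) (\<lambda>_. I (Suc i)) t m'"
        if i: "i < n" and I: "I i m'" for i t m'
      proof -
        let ?j = "n - Suc i"
        have j: "?j < n" "Suc ?j = n - i" using i by auto
        have I': "ready n a b k s m'" "holds \<beta> m' ColR (Suc n) (a div \<beta> ^ Suc ?j mod b)"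
          using I unfolding I_def j by auto
        show ?thesis
        proof (rule wp_mono[OF wp_next_digit[OF I' j(1)]], goal_cases)
          case (1 t m'')
          then have in': "inner ?j m' m''" by auto
          have "m'' (ColQ, l) = a div b div \<beta> ^ l mod \<beta>" if "l < n" "?j \<le> l" for l
          proof (cases "l = ?j")
            case False
            with that j have "n - i \<le> l" by linarith
            then show ?thesis using I in' that False by (auto simp: I_def inner_def)
          qed (use 1 in simp)
          then show ?case using 1 ready_inner[OF I'(1) in'] by (simp add: I_def)
        qed
      qed
      show ?case
      proof (rule wp_mono[OF wp_rep[where I = I, OF init body]], assumption, assumption)
        fix t m' assume I: "I n m'"
        then have R: "holds \<beta> m' ColR (Suc n) (a mod b)" by (simp add: I_def)
        from I holds_digit[OF R] show "tables \<beta> m' \<and>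
          (\<forall>i<n. m' (ColQ, i) = a div b div \<beta> ^ i mod \<beta> \<and> m' (ColR, i) = a mod b div \<beta> ^ i mod \<beta>)"
          by (simp add: I_def ready_def)
      qed
    qed (use k eq in simp_all)
  qed
qed

end

section \<open>Precomputation\<close>

text \<open>The index of \<open>J\<close> counts the remaining rounds, matching the iterate in the
  definition of \<open>wp\<close>, so termination is included. Time belongs to \<open>J\<close> here
  because the number of rounds depends on \<open>N\<close>.\<close>

lemma wp_while:
  assumes "J n t m"
    and "\<And>k t m. k < n \<Longrightarrow> J (Suc k) t m \<Longrightarrow> m x \<noteq> 0 \<and> wp N xs L c (J k) (t + 4) m"
    and "\<And>t m. J 0 t m \<Longrightarrow> m x = 0 \<and> Q (t + 4) m"
  shows "wp N xs L (While x c) Q t m"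
proof -
  let ?F = "\<lambda>I t m. m x \<noteq> 0 \<and> wp N xs L c I (t + 4) m"
  have "k \<le> n \<Longrightarrow> J k t m \<Longrightarrow> (?F ^^ k) (\<lambda>t m. m x = 0 \<and> Q (t + 4) m) t m" for k t m
  proof (induction k arbitrary: t m)
    case 0
    then show ?case using assms(3) by simp
  next
    case (Suc k)
    have "m x \<noteq> 0" "wp N xs L c (J k) (t + 4) m" using assms(2)[of k t m] Suc.prems by simp_all
    with Suc.IH Suc.prems show ?case by (auto elim: wp_mono)
  qed
  with assms(1) show ?thesis by auto
qed

declare wp.simps(11) [simp del]

text \<open>The only way to count down is to look up the predecessor in a table.\<close>

definition for_loop :: "loc \<Rightarrow> com \<Rightarrow> com" where
  "for_loop c body = While c (body ;; Get c TPred c)"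

text \<open>\<open>J\<close> counts finished rounds while the counter falls. The body must preserve
  the counter and leave its predecessor entry valid; 22 pays for the countdown and 4 for the
  test.\<close>

lemma wp_for_loop:
  assumes "J 0 t m" "m c = n"
    and body: "\<And>i t m. i < n \<Longrightarrow> J i t m \<Longrightarrow> m c = n - i \<Longrightarrow>
      wp N xs L body (\<lambda>t m. m c = n - i \<and> m (TPred, n - i) = n - i - 1 \<and>
        J (Suc i) (t + 22) (m(c := n - i - 1))) (t + 4) m"
    and "\<And>t m. J n t m \<Longrightarrow> Q (t + 4) m"
  shows "wp N xs L (for_loop c body) Q t m"
  unfolding for_loop_def
proof (rule wp_while[where J = "\<lambda>k t m. J (n - k) t m \<and> m c = k"])
  fix k t m
  assume k: "k < n" and J: "J (n - Suc k) t m \<and> m c = Suc k"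
  from body[of "n - Suc k" t m] k J
  have "wp N xs L body (\<lambda>t m. m c = Suc k \<and> m (TPred, Suc k) = k \<and> J (n - k) (t + 22) (m(c := k))) (t + 4) m"
    by (simp add: Suc_diff_Suc)
  then have "wp N xs L (body ;; Get c TPred c) (\<lambda>t m. J (n - k) t m \<and> m c = k) (t + 4) m"
    by (rule wp_seqI) auto
  with J show "m c \<noteq> 0 \<and> wp N xs L (body ;; Get c TPred c) (\<lambda>t m. J (n - k) t m \<and> m c = k) (t + 4) m"
    by simp
qed (use assms in auto)

text \<open>Removes the real square root: the base is the least \<open>i\<close> with
  \<open>N \<le> i * i\<close>, which a loop can find.\<close>

lemma less_base_iff: "i < base N \<longleftrightarrow> i * i < N"
proof -
  have "i < base N \<longleftrightarrow> int i < \<lceil>sqrt (real N)\<rceil>"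
    unfolding base_def by linarith
  also have "\<dots> \<longleftrightarrow> real i < sqrt (real N)" by (simp add: less_ceiling_iff)
  also have "\<dots> \<longleftrightarrow> (real i)\<^sup>2 < real N"
    by (metis of_nat_0_le_iff real_less_rsqrt real_sqrt_less_iff real_sqrt_abs2 power2_eq_square abs_of_nonneg real_sqrt_power)
  also have "\<dots> \<longleftrightarrow> i * i < N" by (simp add: power2_eq_square flip: of_nat_mult)
  finally show ?thesis .
qed

text \<open>This makes tables with \<open>\<beta> * \<beta>\<close> entries linear in
  \<open>N\<close>. With \<open>base N = i + 1\<close> one has \<open>i * i < N\<close>, and
  \<open>2 * i + 1\<close> is at most \<open>2 * (i * i) + 1\<close>.\<close>

lemma base_sq_le:
  assumes "0 < N"
  shows "base N * base N \<le> 4 * N"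
proof -
  obtain i where i: "base N = Suc i"
    using less_base_iff[of 0 N] assms by (cases "base N") auto
  then have "i * i < N" using less_base_iff[of i N] by simp
  moreover have "i \<le> i * i" by (cases i) simp_all
  moreover have "Suc i * Suc i = i * i + 2 * i + 1" by simp
  ultimately show ?thesis unfolding i by linarith
qed

lemma base_le: "0 < N \<Longrightarrow> base N \<le> N"
  using less_base_iff[of N N] by (cases N) auto

text \<open>
  Equality with \<open>N\<close> cannot be tested directly; it is detected by a mark placed at index \<open>N\<close>.
\<close>

definition count_up :: com where
  "count_up = Size (Tmp, 0) ;; Const (Tmp, 1) 1 ;; Put TLess (Tmp, 0) (Tmp, 1) ;;
     Const (Tmp, 2) 0 ;; Const (Tmp, 3) 1 ;;
     While (Tmp, 3) (Put TLess (Tmp, 2) (Tmp, 1) ;; Plus (Tmp, 4) (Tmp, 2) (Tmp, 1) ;;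
       Put TPred (Tmp, 4) (Tmp, 2) ;; Move (Tmp, 2) (Tmp, 4) ;; Get (Tmp, 5) TLess (Tmp, 2) ;;
       IfZero (Tmp, 5) (Const (Tmp, 3) 1) (Const (Tmp, 3) 0))"

text \<open>
  \<open>Tmp 4\<close> holds \<open>i * i + 1\<close>, and \<open>TLess\<close> marks exactly the indices up to \<open>N\<close>, so the loop runs while
  \<open>i * i < N\<close>.
\<close>

definition square_root :: com where
  "square_root = Const (Tmp, 2) 0 ;; Get (Tmp, 3) TLess (Tmp, 1) ;; Const (Tmp, 4) 1 ;;
     While (Tmp, 3) (Plus (Tmp, 4) (Tmp, 4) (Tmp, 2) ;; Plus (Tmp, 4) (Tmp, 4) (Tmp, 2) ;;
       Plus (Tmp, 4) (Tmp, 4) (Tmp, 1) ;; Plus (Tmp, 2) (Tmp, 2) (Tmp, 1) ;;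
       Get (Tmp, 3) TLess (Tmp, 4)) ;; Get (Glob, 0) TPred (Tmp, 2)"

text \<open>\<open>Norm 2\<close> runs through all indices \<open>\<beta> * x + y\<close>, while
  \<open>Norm 3\<close>, \<open>Norm 4\<close> and \<open>Norm 5\<close> follow with
  \<open>x\<close>, \<open>y\<close> and \<open>x * y\<close>. Quotient, remainder and product are
  thus known at each index without being computed from it.\<close>

definition digit_tables :: com where
  "digit_tables = Const (Norm, 2) 0 ;; Const (Norm, 3) 0 ;; Move (Norm, 0) (Tmp, 2) ;;
     for_loop (Norm, 0) (Put TRow (Norm, 3) (Norm, 2) ;; Const (Norm, 5) 0 ;; Const (Norm, 4) 0 ;;
       Move (Norm, 1) (Tmp, 2) ;;
       for_loop (Norm, 1) (Put THi (Norm, 2) (Norm, 3) ;; Put TLo (Norm, 2) (Norm, 4) ;;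
         Put TMul (Norm, 2) (Norm, 5) ;; Plus (Norm, 5) (Norm, 5) (Norm, 3) ;;
         Plus (Norm, 4) (Norm, 4) (Tmp, 1) ;; Plus (Norm, 2) (Norm, 2) (Tmp, 1)) ;;
       Plus (Norm, 3) (Norm, 3) (Tmp, 1))"

text \<open>
  Entry \<open>x\<close> of row \<open>y\<close> receives every \<open>j\<close> for which \<open>j * (y + 1) / \<beta>\<close> rounds up to \<open>x\<close>; the last of
  these is \<open>\<beta> * x div (y + 1)\<close>.
\<close>

definition quotient_table :: com where
  "quotient_table = Const (Norm, 2) 0 ;; Const (Norm, 3) 1 ;; Move (Norm, 0) (Tmp, 2) ;;
     for_loop (Norm, 0) (Const (Norm, 5) 0 ;; Const (Norm, 4) 0 ;; Move (Norm, 1) (Tmp, 2) ;;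
       for_loop (Norm, 1) (Plus (Norm, 6) (Norm, 5) (Glob, 0) ;; Get (Norm, 6) THi (Norm, 6) ;;
         Plus (Norm, 6) (Norm, 6) (Norm, 2) ;; Put TQuo (Norm, 6) (Norm, 4) ;;
         Plus (Norm, 5) (Norm, 5) (Norm, 3) ;; Plus (Norm, 4) (Norm, 4) (Tmp, 1)) ;;
       Plus (Norm, 3) (Norm, 3) (Tmp, 1) ;; Plus (Norm, 2) (Norm, 2) (Tmp, 2))"

definition precompute :: com where
  "precompute = count_up ;; square_root ;; digit_tables ;; quotient_table"

text \<open>The largest value tested by \<open>square_root\<close> is
  \<open>\<beta> * \<beta> + 1\<close>, at most \<open>4 * N + 1\<close>; hence the factor
  5.\<close>

locale precomputation =
  fixes N :: nat and xs :: "nat list" and L \<beta> :: nat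
  assumes N_pos: "0 < N" and base: "\<beta> = base N" and L: "5 * N \<le> L"
begin

lemma sq_le: "\<beta> * \<beta> \<le> 4 * N" "\<beta> * \<beta> < L" "N \<le> L"
  using base_sq_le[OF N_pos] L N_pos by (auto simp: base)

lemma base_bounds: "0 < \<beta>" "\<beta> \<le> N" "\<beta> \<le> \<beta> * \<beta>"
  using less_base_iff[of 0 N] base_le[OF N_pos] N_pos by (auto simp: base)

text \<open>The zero initial memory matters: beyond \<open>N\<close> the column \<open>TLess\<close>
  is never written and therefore reads 0.\<close>

lemma wp_count_up:
  "wp N xs L count_up (\<lambda>t m. t \<le> 300 * N \<and> m (Tmp, 1) = 1 \<and>
     (\<forall>j. m (TLess, j) = (if j \<le> N then 1 else 0)) \<and> (\<forall>j<N. m (TPred, Suc j) = j)) 0 (\<lambda>_. 0)"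
proof -
  \<comment> \<open>A round costs 140 = 6 * 22 + 2 * 4, and 110 = 5 * 22 pays for the
    initialisation.\<close>
  define J where "J k t m \<longleftrightarrow> t + 140 * k \<le> 140 * N + 110 \<and> m (Tmp, 1) = 1 \<and> k \<le> N \<and>
    m (Tmp, 2) = N - k \<and> m (Tmp, 3) = (if k = 0 then 0 else 1) \<and>
    (\<forall>j. m (TLess, j) = (if j < N - k \<or> j = N then 1 else 0)) \<and>
    (\<forall>j < N - k. m (TPred, Suc j) = j)" for k t and m :: mem
  have L1: "1 \<le> L" using L N_pos by simp
  have loop: "wp N xs L
     (While (Tmp, 3) (Put TLess (Tmp, 2) (Tmp, 1) ;; Plus (Tmp, 4) (Tmp, 2) (Tmp, 1) ;;
       Put TPred (Tmp, 4) (Tmp, 2) ;; Move (Tmp, 2) (Tmp, 4) ;; Get (Tmp, 5) TLess (Tmp, 2) ;;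
       IfZero (Tmp, 5) (Const (Tmp, 3) 1) (Const (Tmp, 3) 0)))
     (\<lambda>t m. t \<le> 300 * N \<and> m (Tmp, 1) = 1 \<and>
        (\<forall>j. m (TLess, j) = (if j \<le> N then 1 else 0)) \<and> (\<forall>j<N. m (TPred, Suc j) = j)) t m"
    if "J N t m" for t m
  proof (rule wp_while[where J = J, OF that], goal_cases)
    case (1 k t m)
    then have i: "N - Suc k < N" "N - k = Suc (N - Suc k)" "Suc (N - Suc k) \<le> L"
      using sq_le by auto
    \<comment> \<open>The next index lies beyond all marks set by the loop so far, so finding it
      marked means that it is \<open>N\<close>.\<close>
    have "Suc (N - Suc k) = N \<longleftrightarrow> k = 0" using 1 by auto
    with 1 i L1 show ?case by (auto simp: J_def less_Suc_eq)
  next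
    case (2 t m)
    then show ?case using N_pos by (auto simp: J_def)
  qed
  have "J N 110 (((\<lambda>_. 0)((Tmp, 0) := N, (Tmp, 1) := 1, (TLess, N) := 1, (Tmp, 2) := 0, (Tmp, 3) := 1)))"
    using N_pos by (simp add: J_def)
  from loop[OF this] show ?thesis
    using sq_le L1 by (simp add: count_up_def)
qed

definition counted :: "mem \<Rightarrow> bool" where
  "counted m \<longleftrightarrow> m (Tmp, 1) = 1 \<and> (\<forall>j<N. m (TPred, Suc j) = j) \<and>
     m (Tmp, 2) = \<beta> \<and> m (Glob, 0) = \<beta> - 1"

text \<open>Squares are updated by \<open>(i + 1) * (i + 1) = i * i + i + i + 1\<close>, using
  addition alone. A round costs 114 = 5 * 22 + 4.\<close>

lemma wp_square_root:
  assumes m: "m (Tmp, 1) = 1" "\<forall>j. m (TLess, j) = (if j \<le> N then 1 else 0)"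
    "\<forall>j<N. m (TPred, Suc j) = j"
  shows "wp N xs L square_root (\<lambda>t' m'. t' \<le> t + 300 * N \<and> counted m') t m"
proof -
  define J where "J k t' m' \<longleftrightarrow> t' + 114 * k \<le> t + 114 * \<beta> + 66 \<and> unch {Tmp} m m' \<and>
    m' (Tmp, 1) = 1 \<and> k \<le> \<beta> \<and> m' (Tmp, 2) = \<beta> - k \<and> m' (Tmp, 4) = Suc ((\<beta> - k) * (\<beta> - k)) \<and>
    m' (Tmp, 3) = (if k = 0 then 0 else 1)" for k t' and m' :: mem
  have loop: "wp N xs L
     (While (Tmp, 3) (Plus (Tmp, 4) (Tmp, 4) (Tmp, 2) ;; Plus (Tmp, 4) (Tmp, 4) (Tmp, 2) ;;
       Plus (Tmp, 4) (Tmp, 4) (Tmp, 1) ;; Plus (Tmp, 2) (Tmp, 2) (Tmp, 1) ;;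
       Get (Tmp, 3) TLess (Tmp, 4)))
     (\<lambda>t' m'. t' + 22 \<le> t + 300 * N \<and> unch {Tmp} m m' \<and> m' (Tmp, 1) = 1 \<and> m' (Tmp, 2) = \<beta>) t' m'"
    if "J \<beta> t' m'" for t' m'
  proof (rule wp_while[where J = J, OF that], goal_cases)
    case (1 k t' m')
    define i where "i = \<beta> - Suc k"
    have i: "\<beta> - k = Suc i" "Suc i \<le> \<beta>" using 1 by (auto simp: i_def)
    have "Suc i * Suc i \<le> \<beta> * \<beta>" using i by (intro mult_le_mono) auto
    then have le: "Suc (i * i) + i + i + 1 \<le> Suc (\<beta> * \<beta>)" by simp
    have un: "unch {Tmp} m m'" using 1 by (simp add: J_def)
    have less: "m' (TLess, Suc (Suc (i * i + i + i))) = (if k = 0 then 0 else 1)"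
    proof -
      have "Suc (Suc (i * i + i + i)) = Suc (Suc i * Suc i)" by simp
      also have "\<dots> \<le> N \<longleftrightarrow> Suc i < \<beta>"
        using less_base_iff[of "Suc i" N] by (simp add: base Suc_le_eq)
      also have "\<dots> \<longleftrightarrow> k \<noteq> 0" using i by auto
      finally show ?thesis using unchD[OF un] m(2) by auto
    qed
    show ?case using 1 i le less sq_le base_bounds
      by (auto simp: J_def i_def[symmetric])
  next
    case (2 t' m')
    then show ?case using base_bounds by (auto simp: J_def)
  qed
  have "J \<beta> (t + 66) (m((Tmp, 2) := 0, (Tmp, 3) := 1, (Tmp, 4) := 1))"
    using base_bounds m by (simp add: J_def)
  from loop[OF this] have
    "wp N xs L (While (Tmp, 3) (Plus (Tmp, 4) (Tmp, 4) (Tmp, 2) ;; Plus (Tmp, 4) (Tmp, 4) (Tmp, 2) ;;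
       Plus (Tmp, 4) (Tmp, 4) (Tmp, 1) ;; Plus (Tmp, 2) (Tmp, 2) (Tmp, 1) ;;
       Get (Tmp, 3) TLess (Tmp, 4)) ;; Get (Glob, 0) TPred (Tmp, 2))
       (\<lambda>t' m'. t' \<le> t + 300 * N \<and> counted m') (t + 66) (m((Tmp, 2) := 0, (Tmp, 3) := 1, (Tmp, 4) := 1))"
  proof (rule wp_seqI, goal_cases)
    case (1 t' m')
    then have "m' (TPred, j) = m (TPred, j)" for j using unchD[of "{Tmp}" m m'] by simp
    moreover from this have "m' (TPred, \<beta>) = \<beta> - 1"
      using m(3)[rule_format, of "\<beta> - 1"] base_bounds by simp
    ultimately show ?case using 1 m(3) by (simp add: counted_def)
  qed
  then show ?thesis
    using m sq_le N_pos by (simp add: square_root_def add.commute)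
qed

lemma counted_unch: "counted m \<Longrightarrow> unch C m m' \<Longrightarrow> C \<inter> {Tmp, TPred, Glob} = {} \<Longrightarrow> counted m'"
  using unchD[of C m m'] by (auto simp: counted_def)

lemma counted_pred: "counted m \<Longrightarrow> 0 < i \<Longrightarrow> i \<le> \<beta> \<Longrightarrow> m (TPred, i) = i - 1"
  using base_bounds by (cases i) (auto simp: counted_def)

lemma wp_digit_tables:
  assumes m: "counted m"
  shows "wp N xs L digit_tables (\<lambda>t' m'. t' \<le> t + 2000 * N \<and> counted m' \<and>
    (\<forall>v < \<beta> * \<beta>. m' (THi, v) = v div \<beta> \<and> m' (TLo, v) = v mod \<beta> \<and>
       m' (TMul, v) = (v div \<beta>) * (v mod \<beta>)) \<and> (\<forall>x < \<beta>. m' (TRow, x) = \<beta> * x)) t m"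
proof -
  let ?C = "{Norm, THi, TLo, TMul, TRow}"
  define filled where "filled p m' \<longleftrightarrow> (\<forall>v<p. m' (THi, v) = v div \<beta> \<and> m' (TLo, v) = v mod \<beta> \<and>
     m' (TMul, v) = (v div \<beta>) * (v mod \<beta>))" for p and m' :: mem
  \<comment> \<open>158 = 7 * 22 + 4 is the cost of an inner round including its countdown; a row
    adds 140 steps of its own, rounded up to 150.\<close>
  define J where "J i t' m' \<longleftrightarrow> t' \<le> t + 66 + i * (158 * \<beta> + 150) \<and> unch ?C m m' \<and>
    m' (Norm, 2) = \<beta> * i \<and> m' (Norm, 3) = i \<and> filled (\<beta> * i) m' \<and> (\<forall>x<i. m' (TRow, x) = \<beta> * x)"
    for i t' and m' :: mem
  \<comment> \<open>\<open>c\<close> remembers the counter of the outer loop and \<open>s\<close>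
    the time at which the inner loop is entered.\<close>
  define K where "K c s i j t' m' \<longleftrightarrow> t' \<le> s + j * 158 \<and> unch ?C m m' \<and> m' (Norm, 0) = c \<and>
    m' (Norm, 2) = \<beta> * i + j \<and> m' (Norm, 3) = i \<and> m' (Norm, 4) = j \<and> m' (Norm, 5) = i * j \<and>
    filled (\<beta> * i + j) m' \<and> (\<forall>x\<le>i. m' (TRow, x) = \<beta> * x)"
    for c s i j t' and m' :: mem
  have inner: "wp N xs L
      (for_loop (Norm, 1) (Put THi (Norm, 2) (Norm, 3) ;; Put TLo (Norm, 2) (Norm, 4) ;;
         Put TMul (Norm, 2) (Norm, 5) ;; Plus (Norm, 5) (Norm, 5) (Norm, 3) ;;
         Plus (Norm, 4) (Norm, 4) (Tmp, 1) ;; Plus (Norm, 2) (Norm, 2) (Tmp, 1)))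
      (\<lambda>t'. K c (s + 4) i \<beta> t') t' m'"
    if i: "i < \<beta>" and init: "K c s i 0 t' m'" "m' (Norm, 1) = \<beta>" for c s i t' m'
  proof (rule wp_for_loop[where J = "K c s i", OF init], goal_cases)
    case (1 j t' m')
    have un: "unch ?C m m'" using 1 by (simp add: K_def)
    have cn: "counted m'" using counted_unch[OF m un] by simp
    have pr: "m' (TPred, \<beta> - j) = \<beta> - j - 1" using counted_pred[OF cn] 1 by simp
    have "\<beta> * i + j < \<beta> * Suc i" using 1 by simp
    also have "\<dots> \<le> \<beta> * \<beta>" using i by (intro mult_left_mono) auto
    finally have p: "\<beta> * i + j < \<beta> * \<beta>" .
    have "i * Suc j \<le> \<beta> * \<beta>" using i 1 by (intro mult_le_mono) auto
    then have v: "i * j + i \<le> \<beta> * \<beta>" by simp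
    have one: "m' (Tmp, 1) = 1" using cn by (simp add: counted_def)
    show ?case
      using 1 p v sq_le base_bounds pr one
      by (auto simp: K_def filled_def less_Suc_eq)
  next
    case (2 t m)
    then show ?case by (simp add: K_def)
  qed
  have outer: "wp N xs L
      (for_loop (Norm, 0) (Put TRow (Norm, 3) (Norm, 2) ;; Const (Norm, 5) 0 ;; Const (Norm, 4) 0 ;;
       Move (Norm, 1) (Tmp, 2) ;;
       for_loop (Norm, 1) (Put THi (Norm, 2) (Norm, 3) ;; Put TLo (Norm, 2) (Norm, 4) ;;
         Put TMul (Norm, 2) (Norm, 5) ;; Plus (Norm, 5) (Norm, 5) (Norm, 3) ;;
         Plus (Norm, 4) (Norm, 4) (Tmp, 1) ;; Plus (Norm, 2) (Norm, 2) (Tmp, 1)) ;;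
       Plus (Norm, 3) (Norm, 3) (Tmp, 1)))
     (\<lambda>t' m'. J \<beta> (t' - 4) m') t' m'"
    if "J 0 t' m'" "m' (Norm, 0) = \<beta>" for t' m'
  proof (rule wp_for_loop[where J = J, OF that], goal_cases)
    case (1 i t' m')
    have un: "unch ?C m m'" using 1 by (simp add: J_def)
    have cn: "counted m'" using counted_unch[OF m un] by simp
    let ?m = "m'((TRow, i) := \<beta> * i, (Norm, 5) := 0, (Norm, 4) := 0, (Norm, 1) := \<beta>)"
    have K0: "K (\<beta> - i) (t' + 92) i 0 (t' + 92) ?m"
      using 1 by (auto simp: K_def J_def filled_def)
    have "wp N xs L (for_loop (Norm, 1) (Put THi (Norm, 2) (Norm, 3) ;; Put TLo (Norm, 2) (Norm, 4) ;;
         Put TMul (Norm, 2) (Norm, 5) ;; Plus (Norm, 5) (Norm, 5) (Norm, 3) ;;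
         Plus (Norm, 4) (Norm, 4) (Tmp, 1) ;; Plus (Norm, 2) (Norm, 2) (Tmp, 1)) ;;
       Plus (Norm, 3) (Norm, 3) (Tmp, 1))
       (\<lambda>t m. m (Norm, 0) = \<beta> - i \<and> m (TPred, \<beta> - i) = \<beta> - i - 1 \<and>
        J (Suc i) (t + 22) (m((Norm, 0) := \<beta> - i - 1))) (t' + 92) ?m"
    proof (rule wp_seqI[OF inner[OF 1(1) K0]], goal_cases)
      case (2 t2 m2)
      have un2: "unch ?C m m2" using 2 by (simp add: K_def)
      have cn2: "counted m2" using counted_unch[OF m un2] by simp
      have "m2 (TPred, \<beta> - i) = \<beta> - i - 1" using counted_pred[OF cn2] 1 by simp
      moreover have "m2 (Tmp, 1) = 1" using cn2 by (simp add: counted_def)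
      moreover have "Suc i \<le> L" using 1 base_bounds sq_le by simp
      ultimately show ?case
        using 2 1 by (auto simp: K_def J_def filled_def less_Suc_eq_le algebra_simps)
    qed simp
    moreover have "m' (Norm, 2) = \<beta> * i" "m' (Norm, 3) = i" using 1 by (simp_all add: J_def)
    moreover have "m' (Tmp, 2) = \<beta>" using cn by (simp add: counted_def)
    ultimately show ?case by (simp add: add.commute)
  next
    case (2 t m)
    then show ?case by simp
  qed
  have J0: "J 0 (t + 66) (m((Norm, 2) := 0, (Norm, 3) := 0, (Norm, 0) := \<beta>))"
    by (simp add: J_def filled_def)
  have fin: "t' \<le> t + 2000 * N \<and> counted m' \<and> filled (\<beta> * \<beta>) m' \<and> (\<forall>x < \<beta>. m' (TRow, x) = \<beta> * x)"
    if "J \<beta> (t' - 4) m'" for t' m'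
  proof -
    have "t' \<le> t + 70 + \<beta> * (158 * \<beta> + 150)" using that by (auto simp: J_def)
    also have "\<dots> = t + 70 + 158 * (\<beta> * \<beta>) + 150 * \<beta>" by (simp add: algebra_simps)
    also have "\<dots> \<le> t + 2000 * N" using sq_le base_bounds N_pos by linarith
    finally have "t' \<le> t + 2000 * N" .
    moreover have "counted m'" by (rule counted_unch[OF m, of ?C]) (use that in \<open>auto simp: J_def\<close>)
    ultimately show ?thesis using that by (simp add: J_def)
  qed
  have "wp N xs L digit_tables (\<lambda>t' m'. J \<beta> (t' - 4) m') t m"
    using outer[OF J0] m by (simp add: digit_tables_def counted_def add.commute)
  from wp_mono[OF this fin] show ?thesis by (simp add: filled_def)
qed

lemma wp_quotient_table:
  assumes m: "counted m" and hi: "\<forall>v < \<beta> * \<beta>. m (THi, v) = v div \<beta>"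
  shows "wp N xs L quotient_table (\<lambda>t' m'. t' \<le> t + 2000 * N \<and> unch {Norm, TQuo} m m' \<and>
    (\<forall>y < \<beta>. \<forall>x \<le> y. m' (TQuo, \<beta> * y + x) = \<beta> * x div Suc y)) t m"
proof -
  let ?C = "{Norm, TQuo}"
  define rows where "rows i m' \<longleftrightarrow> (\<forall>y<i. \<forall>x\<le>y. m' (TQuo, \<beta> * y + x) = \<beta> * x div Suc y)"
    for i and m' :: mem
  \<comment> \<open>Entry \<open>x\<close> receives its final value in round
    \<open>\<beta> * x div Suc i\<close>, so before round \<open>j\<close> exactly the entries with
    a smaller such number are known to be final.\<close>
  define row where "row i j m' \<longleftrightarrow>
    (\<forall>x\<le>i. \<beta> * x div Suc i < j \<longrightarrow> m' (TQuo, \<beta> * i + x) = \<beta> * x div Suc i)"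
    for i j and m' :: mem
  define J where "J i t' m' \<longleftrightarrow> t' \<le> t + 66 + i * (158 * \<beta> + 150) \<and> unch ?C m m' \<and>
    m' (Norm, 2) = \<beta> * i \<and> m' (Norm, 3) = Suc i \<and> rows i m'"
    for i t' and m' :: mem
  define K where "K c s i j t' m' \<longleftrightarrow> t' \<le> s + j * 158 \<and> unch ?C m m' \<and> m' (Norm, 0) = c \<and>
    m' (Norm, 2) = \<beta> * i \<and> m' (Norm, 3) = Suc i \<and> m' (Norm, 4) = j \<and> m' (Norm, 5) = j * Suc i \<and>
    rows i m' \<and> row i j m'"
    for c s i j t' and m' :: mem
  let ?inner = "for_loop (Norm, 1) (Plus (Norm, 6) (Norm, 5) (Glob, 0) ;;
    Get (Norm, 6) THi (Norm, 6) ;; Plus (Norm, 6) (Norm, 6) (Norm, 2) ;;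
    Put TQuo (Norm, 6) (Norm, 4) ;; Plus (Norm, 5) (Norm, 5) (Norm, 3) ;;
    Plus (Norm, 4) (Norm, 4) (Tmp, 1))"
  have inner: "wp N xs L ?inner (\<lambda>t'. K c (s + 4) i \<beta> t') t' m'"
    if i: "i < \<beta>" and init: "K c s i 0 t' m'" "m' (Norm, 1) = \<beta>" for c s i t' m'
  proof (rule wp_for_loop[where J = "K c s i", OF init], goal_cases)
    case (1 j t' m')
    let ?v = "j * Suc i"
    define l where "l = \<beta> - 1"
    have l: "\<beta> = Suc l" using base_bounds by (simp add: l_def)
    \<comment> \<open>Adding \<open>\<beta> - 1\<close> before the look-up turns the high digit into
      \<open>j * (i + 1) / \<beta>\<close> rounded up.\<close>
    let ?x = "(?v + l) div \<beta>"
    have un: "unch ?C m m'" using 1 by (simp add: K_def)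
    have cn: "counted m'" using counted_unch[OF m un] by simp
    have pr: "m' (TPred, \<beta> - j) = \<beta> - j - 1" using counted_pred[OF cn] 1 by simp
    have one: "m' (Tmp, 1) = 1" "m' (Glob, 0) = l" using cn by (simp_all add: counted_def l_def)
    have "Suc j * Suc i \<le> \<beta> * \<beta>" using i 1 by (intro mult_le_mono) auto
    then have v: "?v + Suc i \<le> \<beta> * \<beta>" by simp
    have "Suc j * \<beta> \<le> \<beta> * \<beta>" using 1 by (intro mult_le_mono) auto
    then have "\<beta> + j * \<beta> \<le> \<beta> * \<beta>" by simp
    moreover have "?v \<le> j * \<beta>" using i by (intro mult_le_mono) auto
    ultimately have p: "?v + l < \<beta> * \<beta>" using l by linarith
    have x: "?x < \<beta>" using p by (simp add: less_mult_imp_div_less)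
    have hix: "m' (THi, ?v + l) = ?x" using unchD[OF un] hi p by simp
    have "\<beta> * i + ?x < \<beta> * Suc i" using x by simp
    also have "\<dots> \<le> \<beta> * \<beta>" using i by (intro mult_le_mono) auto
    finally have q: "\<beta> * i + ?x < \<beta> * \<beta>" .
    \<comment> \<open>The specified entries of earlier rows have indices below
      \<open>\<beta> * i\<close>, where this round does not write.\<close>
    have rows': "rows i m''"
      if upd: "\<And>z. m'' (TQuo, z) = (if z = \<beta> * i + ?x then j else m' (TQuo, z))" for m''
    proof -
      have "\<beta> * y + z \<noteq> \<beta> * i + ?x" if "y < i" "z \<le> y" for y z
      proof -
        have "\<beta> * y + z < \<beta> * Suc y" using that i by simp
        also have "\<dots> \<le> \<beta> * i" using that by (intro mult_le_mono) auto
        finally show ?thesis by linarith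
      qed
      then show ?thesis using 1 by (simp add: rows_def K_def upd)
    qed
    have digit: "(if z = ?x then j else m' (TQuo, \<beta> * i + z)) = \<beta> * z div Suc i"
      if z: "z \<le> i" "\<beta> * z div Suc i < Suc j" for z
    proof (cases "\<beta> * z div Suc i = j")
      case True
      \<comment> \<open>\<open>j * (i + 1)\<close> is at most \<open>\<beta> * z\<close> and less
        than \<open>i + 1 \<le> \<beta>\<close> below it, so division by \<beta> rounds up to
        \<open>z\<close>.\<close>
      have "j * Suc i \<le> \<beta> * z"
        unfolding True[symmetric] by (rule div_times_less_eq_dividend)
      moreover have "\<beta> * z < Suc i + j * Suc i"
        unfolding True[symmetric] by (rule dividend_less_div_times) simp
      ultimately have "?x = z" using i l by (intro div_nat_eqI) (simp_all add: mult.commute)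
      then show ?thesis using True by simp
    next
      case False
      \<comment> \<open>Entry \<open>z\<close> is already final: \<open>j * (i + 1)\<close> now
        exceeds \<open>\<beta> * z\<close>, so this round writes at a larger index.\<close>
      then have less: "\<beta> * z div Suc i < j" using z by simp
      then have "\<beta> * z < ?v" by (simp add: div_less_iff_less_mult)
      then have "Suc z * \<beta> \<le> ?v + l" using l by (simp add: mult.commute)
      then have "Suc z \<le> ?x" using i by (subst less_eq_div_iff_mult_less_eq) auto
      then show ?thesis using less 1 z by (simp add: K_def row_def)
    qed
    have row': "row i (Suc j) m''"
      if upd: "\<And>z. m'' (TQuo, z) = (if z = \<beta> * i + ?x then j else m' (TQuo, z))" for m''
      using digit by (simp add: row_def upd)
    show ?case
      using 1 p v q hix sq_le base_bounds pr one rows' row' i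
      by (simp add: K_def add.commute)
  next
    case (2 t m)
    then show ?case by (simp add: K_def)
  qed
  have outer: "wp N xs L (for_loop (Norm, 0) (Const (Norm, 5) 0 ;; Const (Norm, 4) 0 ;;
       Move (Norm, 1) (Tmp, 2) ;; ?inner ;; Plus (Norm, 3) (Norm, 3) (Tmp, 1) ;;
       Plus (Norm, 2) (Norm, 2) (Tmp, 2))) (\<lambda>t' m'. J \<beta> (t' - 4) m') t' m'"
    if "J 0 t' m'" "m' (Norm, 0) = \<beta>" for t' m'
  proof (rule wp_for_loop[where J = J, OF that], goal_cases)
    case (1 i t' m')
    have un: "unch ?C m m'" using 1 by (simp add: J_def)
    have cn: "counted m'" using counted_unch[OF m un] by simp
    let ?m = "m'((Norm, 5) := 0, (Norm, 4) := 0, (Norm, 1) := \<beta>)"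
    have K0: "K (\<beta> - i) (t' + 70) i 0 (t' + 70) ?m"
      using 1 by (auto simp: K_def J_def rows_def row_def)
    have "wp N xs L (?inner ;; Plus (Norm, 3) (Norm, 3) (Tmp, 1) ;; Plus (Norm, 2) (Norm, 2) (Tmp, 2))
       (\<lambda>t m. m (Norm, 0) = \<beta> - i \<and> m (TPred, \<beta> - i) = \<beta> - i - 1 \<and>
        J (Suc i) (t + 22) (m((Norm, 0) := \<beta> - i - 1))) (t' + 70) ?m"
    proof (rule wp_seqI[OF inner[OF 1(1) K0]], goal_cases)
      case (2 t2 m2)
      have un2: "unch ?C m m2" using 2 by (simp add: K_def)
      have cn2: "counted m2" using counted_unch[OF m un2] by simp
      have pr: "m2 (TPred, \<beta> - i) = \<beta> - i - 1" using counted_pred[OF cn2] 1 by simp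
      have one: "m2 (Tmp, 1) = 1" "m2 (Tmp, 2) = \<beta>" using cn2 by (simp_all add: counted_def)
      have "\<beta> * Suc i \<le> \<beta> * \<beta>" using 1 by (intro mult_le_mono) auto
      then have le: "\<beta> * i + \<beta> \<le> L" using sq_le by simp
      have le': "Suc (Suc i) \<le> L" using 1 base_bounds sq_le by linarith
      have "\<beta> * x div Suc i < \<beta>" if "x \<le> i" for x
      proof -
        have "\<beta> * x < \<beta> * Suc i" using that base_bounds by (intro mult_strict_left_mono) auto
        then show ?thesis by (simp add: less_mult_imp_div_less)
      qed
      with 2 have "rows (Suc i) m2" by (auto simp: K_def rows_def row_def less_Suc_eq)
      then show ?case
        using 2 1 le le' pr one by (auto simp: K_def J_def rows_def algebra_simps)
    qed simp
    moreover have "m' (Tmp, 2) = \<beta>" using cn by (simp add: counted_def)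
    ultimately show ?case by (simp add: add.commute)
  next
    case (2 t m)
    then show ?case by simp
  qed
  have J0: "J 0 (t + 66) (m((Norm, 2) := 0, (Norm, 3) := 1, (Norm, 0) := \<beta>))"
    by (simp add: J_def rows_def)
  have fin: "t' \<le> t + 2000 * N \<and> unch ?C m m' \<and> rows \<beta> m'"
    if "J \<beta> (t' - 4) m'" for t' m'
  proof -
    have "t' \<le> t + 70 + \<beta> * (158 * \<beta> + 150)" using that by (auto simp: J_def)
    also have "\<dots> = t + 70 + 158 * (\<beta> * \<beta>) + 150 * \<beta>" by (simp add: algebra_simps)
    also have "\<dots> \<le> t + 2000 * N" using sq_le base_bounds N_pos by linarith
    finally show ?thesis using that by (simp add: J_def)
  qed
  have "1 \<le> L" using sq_le N_pos by simp
  then have "wp N xs L quotient_table (\<lambda>t' m'. J \<beta> (t' - 4) m') t m"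
    using outer[OF J0] m by (simp add: quotient_table_def counted_def add.commute)
  from wp_mono[OF this fin] show ?thesis by (simp add: rows_def)
qed

lemma wp_precompute:
  "wp N xs L precompute (\<lambda>t m. t \<le> 5000 * N \<and> tables \<beta> m) 0 (\<lambda>_. 0)"
  unfolding precompute_def
proof (rule wp_seqI[OF wp_count_up], goal_cases)
  case (1 t m)
  then have t1: "t \<le> 300 * N" by simp
  show ?case
  proof (rule wp_seqI[OF wp_square_root[where t = t]], goal_cases)
    case (4 t2 m2)
    show ?case
    proof (rule wp_seqI[OF wp_digit_tables[where t = t2]], goal_cases)
      case (2 t3 m3)
      then have c3: "counted m3" and h3: "\<forall>v < \<beta> * \<beta>. m3 (THi, v) = v div \<beta>" by auto
      show ?case
      proof (rule wp_mono[OF wp_quotient_table[OF c3 h3, where t = t3]], goal_cases)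
        case (1 t4 m4)
        then have un: "unch {Norm, TQuo} m3 m4" by simp
        have "\<beta> * x + y < \<beta> * \<beta>" if "x < \<beta>" "y < \<beta>" for x y
        proof -
          have "\<beta> * x + y < \<beta> * Suc x" using that by simp
          also have "\<dots> \<le> \<beta> * \<beta>" using that by (intro mult_le_mono) auto
          finally show ?thesis .
        qed
        then have "m3 (TMul, \<beta> * x + y) = x * y" if "x < \<beta>" "y < \<beta>" for x y
          using 2 that by simp
        then have "tables \<beta> m4"
          using 1 2 c3 unchD[OF un] by (simp add: tables_def counted_def)
        then show ?case using 1 2 4 t1 by simp
      qed
    qed (use 4 in simp)
  qed (use 1 in auto)
qed

end

section \<open>Running time and assembly\<close>

text \<open>A conditional is charged for both branches, which keeps the bounds additive. The value
  for \<open>While\<close> is a default, as time bounds are claimed under \<open>loop_free\<close>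
  only.\<close>

primrec cost :: "com \<Rightarrow> nat" where
  "cost Skip = 0"
| "cost (Const x n) = 22"
| "cost (Size x) = 22"
| "cost (Read x n) = 22"
| "cost (Move x y) = 22"
| "cost (Plus x y z) = 22"
| "cost (Get x j y) = 22"
| "cost (Put j y z) = 22"
| "cost (c ;; d) = cost c + cost d"
| "cost (IfZero x c d) = 4 + cost c + cost d"
| "cost (While x c) = 0"

primrec loop_free :: "com \<Rightarrow> bool" where
  "loop_free Skip = True"
| "loop_free (Const x n) = True"
| "loop_free (Size x) = True"
| "loop_free (Read x n) = True"
| "loop_free (Move x y) = True"
| "loop_free (Plus x y z) = True"
| "loop_free (Get x j y) = True"
| "loop_free (Put j y z) = True"
| "loop_free (c ;; d) = (loop_free c \<and> loop_free d)"
| "loop_free (IfZero x c d) = (loop_free c \<and> loop_free d)"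
| "loop_free (While x c) = False"

text \<open>Separates timing from correctness: a result proved with a time-blind postcondition
  acquires a time bound that depends on the syntax alone.\<close>

lemma wp_cost:
  "loop_free c \<Longrightarrow> wp N xs L c Q t m \<Longrightarrow> wp N xs L c (\<lambda>t' m'. Q t' m' \<and> t' \<le> t + cost c) t m"
proof (induction c arbitrary: Q t m)
  case (Seq c d)
  then have "wp N xs L c (\<lambda>t' m'. wp N xs L d Q t' m' \<and> t' \<le> t + cost c) t m" by simp
  then have "wp N xs L c (wp N xs L d (\<lambda>t' m'. Q t' m' \<and> t' \<le> t + cost (c ;; d))) t m"
  proof (rule wp_mono, goal_cases)
    case (1 t1 m1)
    with Seq have "wp N xs L d (\<lambda>t' m'. Q t' m' \<and> t' \<le> t1 + cost d) t1 m1" by simp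
    then show ?case by (rule wp_mono) (use 1 in auto)
  qed
  then show ?case by simp
next
  case (IfZero x c d)
  have "wp N xs L c (\<lambda>t' m'. Q t' m' \<and> t' \<le> t + cost (IfZero x c d)) (t + 4) m" if "m x = 0"
    by (rule wp_mono[OF IfZero.IH(1)[of Q "t + 4" m]]) (use that IfZero.prems in auto)
  moreover have "wp N xs L d (\<lambda>t' m'. Q t' m' \<and> t' \<le> t + cost (IfZero x c d)) (t + 4) m" if "m x \<noteq> 0"
    by (rule wp_mono[OF IfZero.IH(2)[of Q "t + 4" m]]) (use that IfZero.prems in auto)
  ultimately show ?case by simp
qed auto

lemma loop_free_rep: "(\<And>i. loop_free (f i)) \<Longrightarrow> loop_free (rep n f)"
  by (induction n) auto

lemma cost_rep: "(\<And>i. cost (f i) \<le> k) \<Longrightarrow> cost (rep n f) \<le> n * k"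
  by (induction n) (auto simp: add.commute intro: add_mono)

lemma cost_mulc: "cost (mulc dst x src n) \<le> 44 + 110 * n"
  unfolding mulc_def by (simp, rule order_trans[OF cost_rep[where k = 110]]) simp_all

lemma cost_subc: "cost (subc dst u v n) \<le> 22 + 198 * n"
  unfolding subc_def by (simp, rule order_trans[OF cost_rep[where k = 198]]) simp_all

lemma cost_copyc: "cost (copyc dst src n) \<le> 22 * n"
  unfolding copyc_def by (subst mult.commute, rule cost_rep) simp

lemma cost_refine: "cost (refine x i n) \<le> 92 + 330 * n"
  unfolding refine_def
  using cost_mulc[of ColW x ColB n] cost_subc[of ColX ColR ColW n] cost_copyc[of ColR ColX n] by simp

text \<open>The eight calls of \<open>refine\<close>, one for the trial digit and seven for
  corrections, dominate; \<open>0 < n\<close> absorbs the additive constants.\<close>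

lemma cost_next_digit:
  assumes "0 < n"
  shows "cost (next_digit j n) \<le> 7000 * n"
proof -
  have "cost (rep n (\<lambda>i. Move (ColX, Suc i) (ColR, i))) \<le> n * 22" by (rule cost_rep) simp
  then have "cost (shift j n) \<le> 44 + 44 * n"
    using cost_copyc[of ColR ColX "Suc n"] by (simp add: shift_def)
  moreover have "cost (trial (Suc n)) \<le> 220 + 110 * n"
    using cost_mulc[of ColX "(Norm, 4)" ColR "Suc n"] by (simp add: trial_def)
  moreover have "cost (rep 7 (\<lambda>_. refine (Norm, 1) j (Suc n))) \<le> 7 * (92 + 330 * Suc n)"
    by (rule cost_rep) (rule cost_refine)
  ultimately show ?thesis
    using cost_refine[of "(Norm, 6)" j "Suc n"] assms by (simp add: next_digit_def)
qed

lemma cost_divide: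
  assumes "0 < n"
  shows "cost (divide n) \<le> 8000 * n\<^sup>2"
proof -
  have "cost (rep n (\<lambda>i. Read (ColA, i) i ;; Read (ColB, i) (n + i))) \<le> n * 44"
    "cost (rep n (\<lambda>i. Const (ColR, i) 0)) \<le> n * 22"
    by (rule cost_rep; simp)+
  then have "cost (load n) \<le> 66 + 66 * n" by (simp add: load_def)
  moreover have "cost (locate n) \<le> n * 70"
    unfolding locate_def by (rule cost_rep) simp
  moreover have "cost (scale (Suc n)) \<le> 264 + 110 * n"
    using cost_mulc[of ColX "(Norm, 4)" ColB "Suc n"] by (simp add: scale_def)
  moreover have "cost (rep n (\<lambda>i. next_digit (n - Suc i) n)) \<le> n * (7000 * n)"
    by (rule cost_rep) (rule cost_next_digit[OF assms])
  ultimately have "cost (divide n) \<le> 330 + 246 * n + n * (7000 * n)" by (simp add: divide_def)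
  moreover have "n \<le> n * n" "1 \<le> n * n" using assms by simp_all
  ultimately show ?thesis unfolding power2_eq_square by linarith
qed

lemma loop_free_divide: "loop_free (divide n)"
  unfolding divide_def load_def locate_def scale_def next_digit_def shift_def trial_def refine_def
    mulc_def subc_def copyc_def loop_free.simps
  by (intro conjI loop_free_rep TrueI; simp add: loop_free_rep)

section \<open>Output code and the complete program\<close>

definition emit :: "loc list \<Rightarrow> instr list" where
  "emit ys = concat (map (\<lambda>x. fetch x @ [Output]) ys)"

lemma length_emit: "length (emit ys) = 3 * length ys"
  by (induction ys) (auto simp: emit_def fetch_def)

lemma emit_correct:
  assumes imm: "\<And>j. Cst j \<in> set P \<Longrightarrow> j \<le> M"
    and "code_at P (pc c) (emit ys)" "good M L c"
  shows "\<exists>c'. reaches P N xs M c (3 * length ys) c' \<and> pc c' = pc c + 3 * length ys \<and>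
    good M L c' \<and> mem_of c' = mem_of c \<and> out c' = out c @ map (mem_of c) ys"
  using assms(2,3)
proof (induction ys arbitrary: c)
  case Nil
  then show ?case using reaches_refl by (intro exI[of _ c]) simp
next
  case (Cons y ys)
  let ?c = "c\<lparr>acc := mem_of c y, pc := pc c + 3, out := out c @ [mem_of c y]\<rparr>"
  have code: "code_at P (pc c) (fetch y @ [Output])" "code_at P (pc c + 3) (emit ys)"
    using Cons.prems(1) by (simp_all add: emit_def fetch_def eval_nat_numeral)
  have "addr y \<le> M" using code_at_set[OF code(1)] imm by (auto simp: fetch_def)
  then have "straight N xs M (fetch y @ [Output]) c = Some ?c"
    using Cons.prems(2)
    by (simp add: straight_append straight_fetch good_def bounded_by_simps bounded_by_def[of M c] mem_of_def)
  from straight_reaches[OF code(1) this]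
  have r: "reaches P N xs M c 3 ?c" by (simp add: fetch_def numeral_3_eq_3)
  have g: "good M L ?c"
    using Cons.prems(2) by (auto simp: good_def bounded_by_simps bounded_by_def[of M c] mem_of_def)
  from Cons.IH[of ?c] code(2) g obtain c' where c': "reaches P N xs M ?c (3 * length ys) c'"
    "pc c' = pc ?c + 3 * length ys" "good M L c'" "mem_of c' = mem_of ?c"
    "out c' = out ?c @ map (mem_of ?c) ys" by auto
  then show ?case using reaches_trans[OF r c'(1)] by (intro exI[of _ c']) simp
qed

theorem theorem5p4:
  "\<exists>C::nat. \<forall>d::nat. d \<ge> 1 \<longrightarrow>
     (\<exists>(P::program) (l::nat) (K::nat). \<forall>N::nat. N > 0 \<longrightarrow>
       (\<exists>Ready :: config set.
         (\<exists>t c. t \<le> K * N \<and> exec P N [] (K * N) init t c \<and> c \<in> Ready) \<and>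
         (\<forall>c\<in>Ready. \<forall>a b::nat. a < N ^ d \<and> b < N ^ d \<and> b > 0 \<longrightarrow>
            (\<exists>t c'. t \<le> C * d ^ 4 \<and> divides_in P l d N (K * N) c a b t c' \<and> c' \<in> Ready))))"
\<comment> \<open>With \<open>n = 2 * d\<close> digits, division costs at most
  \<open>8000 * (2 * d)^2\<close> and output \<open>12 * d\<close>. The bound is quadratic in
  \<open>d\<close>, well within the fourth power.\<close>
proof (rule exI[of _ 40000], intro allI impI)
  fix d :: nat
  assume d: "1 \<le> d"
  define n where "n = 2 * d"
  have n: "0 < n" using d by (simp add: n_def)
  \<comment> \<open>Between precomputation and division stands one jump to the end \<open>e\<close>,
    where the machine halts.\<close>
  define l where "l = Suc (csize precompute)"
  define ys where "ys = map (Pair ColQ) [0..<n] @ map (Pair ColR) [0..<n]"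
  define e where "e = l + csize (divide n) + 3 * (2 * n)"
  define P where "P = compile 0 precompute @ [Jzero e e] @ compile l (divide n) @ emit ys"
  have len: "length P = e"
    by (simp add: P_def e_def l_def length_emit ys_def)
  have pre_code: "code_at P 0 (compile 0 precompute)"
    using code_at_middle[of "[]"] by (simp add: P_def)
  have jump_code: "code_at P (csize precompute) [Jzero e e]"
    using code_at_middle[of "compile 0 precompute" "[Jzero e e]" "compile l (divide n) @ emit ys"]
    by (simp add: P_def)
  have div_code: "code_at P l (compile l (divide n))"
    using code_at_middle[of "compile 0 precompute @ [Jzero e e]"] by (simp add: P_def l_def)
  have emit_code: "code_at P (l + csize (divide n)) (emit ys)"
    using code_at_middle[of "compile 0 precompute @ [Jzero e e] @ compile l (divide n)" _ "[]"]
    by (simp add: P_def l_def add.commute)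
  \<comment> \<open>The constants in the program depend on \<open>d\<close> only, so their bound
    \<open>J\<close>, and with it \<open>K\<close>, can be fixed before \<open>N\<close>.\<close>
  have "finite {j. Cst j \<in> set P}"
    using finite_vimageI[of "set P" Cst] by (simp add: inj_on_def vimage_def)
  then obtain J where J: "\<And>j. Cst j \<in> set P \<Longrightarrow> j \<le> J"
    using finite_nat_set_iff_bounded_le by auto
  define K where "K = 16 * (5 + n) + 16 + J + 5001"
  show "\<exists>P l K. \<forall>N. N > 0 \<longrightarrow>
       (\<exists>Ready :: config set.
         (\<exists>t c. t \<le> K * N \<and> exec P N [] (K * N) init t c \<and> c \<in> Ready) \<and>
         (\<forall>c\<in>Ready. \<forall>a b. a < N ^ d \<and> b < N ^ d \<and> b > 0 \<longrightarrow>
            (\<exists>t c'. t \<le> 40000 * d ^ 4 \<and> divides_in P l d N (K * N) c a b t c' \<and> c' \<in> Ready)))"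
  proof (rule exI[of _ P], rule exI[of _ l], rule exI[of _ K], intro allI impI)
    fix N :: nat
    assume N: "0 < N"
    \<comment> \<open>\<open>5 * N\<close> is the room needed by the precomputation;
      \<open>n * N\<close> covers the digit positions up to \<open>n\<close> that
      \<open>locate\<close> stores as values.\<close>
    define L where "L = (5 + n) * N"
    define M where "M = K * N"
    define \<beta> where "\<beta> = base N"
    have "M = 16 * L + 16 * N + J * N + 5001 * N"
      by (simp add: M_def K_def L_def algebra_simps)
    moreover have "J \<le> J * N" using N by simp
    ultimately have M: "16 * L + 16 \<le> M" "J \<le> M" "5000 * N + 1 \<le> M" using N by linarith+
    have imm: "j \<le> M" if "Cst j \<in> set P" for j using J[OF that] M by simp
    have "n \<le> n * N" using N by simp
    then have L: "5 * N \<le> L" "n \<le> L" unfolding L_def add_mult_distrib by linarith+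
    interpret pre: precomputation N "[]" L \<beta>
      by unfold_locales (use N L in \<open>simp_all add: \<beta>_def\<close>)
    \<comment> \<open>Only the bounds and the tables are recorded, so a division may start from
      whatever the previous one left in the working columns.\<close>
    define Ready where "Ready = {c. good M L c \<and> tables \<beta> (mem_of c)}"
    have pre_run: "\<exists>t c. t \<le> M \<and> exec P N [] M init t c \<and> c \<in> Ready"
    proof -
      have mem0: "mem_of init = (\<lambda>_. 0)" and pc0: "pc init = 0" by (simp_all add: mem_of_def init_def)
      have g0: "good M L init" by (simp add: good_def mem0) (simp add: bounded_by_def init_def)
      have "achieves P N [] M L init 0 (\<lambda>t m. t \<le> 5000 * N \<and> tables \<beta> m) (pc init + csize precompute)"
        using pre_code pre.wp_precompute
        by (intro compile_correct imm M g0) (simp_all add: mem0 pc0)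
      then have "achieves P N [] M L init 0 (\<lambda>t m. t \<le> 5000 * N + 1 \<and> tables \<beta> m) e"
        by (rule achieves_trans, intro achieves_Jzero) (use jump_code pc0 in simp_all)
      then obtain t T c where c: "reaches P N [] M init t c" "t \<le> T" "T \<le> 5000 * N + 1"
        "tables \<beta> (mem_of c)" "pc c = e" "good M L c"
        unfolding achieves_def by auto
      have "exec P N [] M c 0 c" using c len by (intro exec.halt) (simp_all add: good_def)
      then have "exec P N [] M init t c" using c(1) unfolding reaches_def by fastforce
      then show ?thesis using c M by (intro exI[of _ t] exI[of _ c]) (simp add: Ready_def)
    qed
    have div_run: "\<exists>t c'. t \<le> 40000 * d ^ 4 \<and> divides_in P l d N M c a b t c' \<and> c' \<in> Ready"
      if c: "c \<in> Ready" and ab: "a < N ^ d" "b < N ^ d" "0 < b" for c a b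
    proof -
      \<comment> \<open>For \<open>N = 1\<close> no positive \<open>b\<close> lies below
        \<open>N ^ d\<close>; this gives the base at least 2 that \<open>radix\<close>
        demands.\<close>
      have "1 < N" using ab N by (cases "N = 1") auto
      then have "1 < \<beta>" using less_base_iff[of 1 N] by (simp add: \<beta>_def)
      let ?xs = "poly_digits N d a @ poly_digits N d b"
      interpret radix N ?xs L \<beta>
        by unfold_locales (use \<open>1 < \<beta>\<close> pre.sq_le in simp_all)
      have "N ^ d \<le> (base N ^ 2) ^ d" by (intro power_mono le_base_sq) simp
      then have Nd: "N ^ d \<le> \<beta> ^ n" by (simp add: power_mult \<beta>_def n_def)
      have pd: "poly_digits N d x = digits \<beta> n x" for x by (simp add: poly_digits_def \<beta>_def n_def)
      let ?Q = "\<lambda>m. tables \<beta> m \<and> (\<forall>i<n. m (ColQ, i) = a div b div \<beta> ^ i mod \<beta> \<and>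
        m (ColR, i) = a mod b div \<beta> ^ i mod \<beta>)"
      let ?c = "c\<lparr>pc := l, out := []\<rparr>"
      have g: "good M L ?c" and tab: "tables \<beta> (mem_of ?c)"
        using c by (simp_all add: Ready_def good_def bounded_by_simps)
      have "wp N ?xs L (divide n) (\<lambda>_. ?Q) 0 (mem_of ?c)"
        using ab Nd by (intro wp_divide[OF tab]) (auto simp: pd L)
      from wp_cost[OF loop_free_divide this]
      have "achieves P N ?xs M L ?c 0 (\<lambda>t m. ?Q m \<and> t \<le> cost (divide n)) (pc ?c + csize (divide n))"
        using div_code by (intro compile_correct imm M g) simp_all
      then obtain t T c1 where c1: "reaches P N ?xs M ?c t c1" "t \<le> T" "T \<le> cost (divide n)"
        "?Q (mem_of c1)" "pc c1 = l + csize (divide n)" "good M L c1" "out c1 = []"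
        unfolding achieves_def by auto
      have "code_at P (pc c1) (emit ys)" using emit_code c1 by simp
      from emit_correct[OF imm this c1(6)] obtain c2 where
        c2: "reaches P N ?xs M c1 (3 * length ys) c2" "pc c2 = pc c1 + 3 * length ys"
        "good M L c2" "mem_of c2 = mem_of c1" "out c2 = out c1 @ map (mem_of c1) ys" by blast
      have "pc c2 = e" using c2 c1 by (simp add: e_def ys_def)
      then have "exec P N ?xs M c2 0 c2" using len c2 by (intro exec.halt) (simp_all add: good_def)
      then have run: "exec P N ?xs M ?c (t + 3 * length ys) c2"
        using reaches_trans[OF c1(1) c2(1)] unfolding reaches_def by fastforce
      have "out c2 = poly_digits N d (a div b) @ poly_digits N d (a mod b)"
        using c2(5) c1(4,7) by (simp add: pd ys_def digits_def)
      with run have "divides_in P l d N M c a b (t + 3 * length ys) c2"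
        by (simp add: divides_in_def)
      moreover have "t + 3 * length ys \<le> 40000 * d ^ 4"
      proof -
        have "t + 3 * length ys \<le> 8000 * n\<^sup>2 + 6 * n"
          using c1(2,3) cost_divide[OF n] by (simp add: ys_def)
        also have "\<dots> = 32000 * d\<^sup>2 + 12 * d" by (simp add: n_def power2_eq_square)
        also have "\<dots> \<le> 40000 * d\<^sup>2" using d by (simp add: power2_eq_square)
        also have "\<dots> \<le> 40000 * d ^ 4" using d by (intro mult_left_mono power_increasing) auto
        finally show ?thesis .
      qed
      moreover have "c2 \<in> Ready" using c2 c1 by (simp add: Ready_def)
      ultimately show ?thesis by blast
    qed
    show "\<exists>Ready :: config set.
         (\<exists>t c. t \<le> K * N \<and> exec P N [] (K * N) init t c \<and> c \<in> Ready) \<and>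
         (\<forall>c\<in>Ready. \<forall>a b. a < N ^ d \<and> b < N ^ d \<and> b > 0 \<longrightarrow>
            (\<exists>t c'. t \<le> 40000 * d ^ 4 \<and> divides_in P l d N (K * N) c a b t c' \<and> c' \<in> Ready))"
    proof (intro exI[of _ Ready] conjI ballI allI impI, goal_cases)
      case 1
      show ?case using pre_run by (simp only: M_def)
    next
      case (2 c a b)
      then show ?case using div_run[of c a b] by (simp only: M_def simp_thms)
    qed
  qed
qed

end
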